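(* Let $t, v \ge 2$ be integers and define \[ c_{t,v} = \prod_{i=0}^{t-1} \frac{v^t - v^i}{v^t - 1}. \] Then, for every integer $k \ge t$, \[ \operatorname{cov}_{\max}(v^t; t, k, v) \le c_{t,v} \frac{k^t}{t!}. \] If $v$ is a prime power and $\frac{v^t-1}{v-1}$ divides $k$, then equality holds, that is, $\operatorname{cov}_{\max}(v^t; t, k, v) = c_{t,v} \frac{k^t}{t!}$. Moreover, for every prime power $v$ and every $k \ge t$, \[ \operatorname{cov}_{\max}(v^t; t, k, v) \ge c_{t,v} \binom{k}{t}. \]
   Context: Let $S$ be a set of $v$ symbols and let $A \in S^{N \times k}$ be an array with $N$ rows and $k$ columns and entries in $S$. For a set $Q$ of $t$ column indices, $A_Q$ denotes the $N \times t$ subarray of $A$ obtained by restricting to the columns in $Q$. The array $A$ covers $Q$ if every sequence in $S^t$ appears at least once as a row of $A_Q$. Let $\operatorname{cov}_t(A)$ denote the number of $t$-element sets of columns covered by $A$. The maximum coverage function is \[ \operatorname{cov}_{\max}(N; t, k, v) = \max\{ \operatorname{cov}_t(A) : A \in S^{N \times k} \}, \] which depends on $S$ only through $v = |S|$. *)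

theory Defs
  imports Complex_Main "HOL-Number_Theory.Number_Theory" "HOL-Number_Theory.Prime_Powers"
begin

text \<open>
  An \<open>N \<times> k\<close> array is a function \<open>A\<close> read only at rows \<open>i < N\<close> and columns \<open>j < k\<close>; its
  values outside this range are irrelevant to everything below.
\<close>

definition arrays :: "nat \<Rightarrow> nat \<Rightarrow> 's set \<Rightarrow> (nat \<Rightarrow> nat \<Rightarrow> 's) set" where
  "arrays N k S = {A. \<forall>i<N. \<forall>j<k. A i j \<in> S}"

text \<open>Row \<open>i\<close> of the subarray \<open>A\<^sub>Q\<close>, with the columns of \<open>Q\<close> kept in increasing order.\<close>

definition subarray_row :: "(nat \<Rightarrow> nat \<Rightarrow> 's) \<Rightarrow> nat set \<Rightarrow> nat \<Rightarrow> 's list" where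
  "subarray_row A Q i = map (A i) (sorted_list_of_set Q)"

definition covers :: "nat \<Rightarrow> 's set \<Rightarrow> (nat \<Rightarrow> nat \<Rightarrow> 's) \<Rightarrow> nat set \<Rightarrow> bool" where
  "covers N S A Q \<longleftrightarrow>
     (\<forall>xs. set xs \<subseteq> S \<and> length xs = card Q \<longrightarrow> (\<exists>i<N. subarray_row A Q i = xs))"

definition cov :: "nat \<Rightarrow> nat \<Rightarrow> nat \<Rightarrow> 's set \<Rightarrow> (nat \<Rightarrow> nat \<Rightarrow> 's) \<Rightarrow> nat" where
  "cov N t k S A = card {Q. Q \<subseteq> {..<k} \<and> card Q = t \<and> covers N S A Q}"

text \<open>
  The maximum coverage function takes the symbol set itself, in place of its size \<open>v = card S\<close>.
  The set of values is bounded by \<open>k choose t\<close>, and is nonempty if \<open>S\<close> is, so \<open>Max\<close> is a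
  genuine maximum.
\<close>

definition cov_max :: "nat \<Rightarrow> nat \<Rightarrow> nat \<Rightarrow> 's set \<Rightarrow> nat" where
  "cov_max N t k S = Max (cov N t k S ` arrays N k S)"

definition cov_const :: "nat \<Rightarrow> nat \<Rightarrow> real" where
  "cov_const t v = (\<Prod>i<t. (real v ^ t - real v ^ i) / (real v ^ t - 1))"

end

theory Submission
  imports Defs "HOL-Analysis.Analysis" "HOL-Algebra.Algebraic_Closure" "HOL-Algebra.Embedded_Algebras"
    "HOL-Combinatorics.Multiset_Permutations"
begin

text \<open>
  With \<open>v ^ t\<close> rows a \<open>t\<close>-set of columns is covered iff no two rows agree on all of it, and
  then every pattern on it occurs exactly once.

  Upper bound. The covered sets form a \<open>t\<close>-uniform hypergraph \<open>H\<close> on the columns. Instead of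
  counting its edges directly, bound the Lagrangian polynomial \<open>\<Sum>Q\<in>H. \<Prod>c\<in>Q. x c\<close> over all probability
  weightings \<open>x\<close> of the columns; equal weights then give the claim. By Motzkin and
  Straus, some maximiser has a support in which any two columns lie in a common edge
  (\<open>lagrangian_maximiser\<close>). Such columns are pairwise balanced, and counting agreements with a
  fixed row shows that there are at most \<open>(v ^ t - 1) / (v - 1)\<close> of them
  (\<open>plackett_burman\<close>). Hence some column \<open>c\<close> has weight at least \<open>(v - 1) / (v ^ t - 1)\<close>. At a
  maximiser the partial derivative along \<open>c\<close> is at least \<open>t\<close> times the maximum, and that derivative
  is the Lagrangian polynomial of the link of \<open>c\<close>. The link lives on the \<open>v ^ (t - 1)\<close> rows that
  carry one fixed symbol in column \<open>c\<close>, so induction on \<open>t\<close> bounds it by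
  \<open>cov_const (t - 1) v / fact (t - 1) * (1 - x c) ^ (t - 1)\<close>, which is exactly what the
  recursion of \<open>cov_const\<close> in \<open>t\<close> requires (\<open>edge_poly_separating_sets_le\<close>).

  Lower bounds. For a prime power \<open>q\<close> take finite fields \<open>K \<subseteq> E\<close> with \<open>q\<close> and \<open>q ^ t\<close> elements, found
  inside an algebraic closure of the prime field (\<open>finite_field_tower\<close>), and a nonzero
  \<open>K\<close>-linear functional \<open>lam\<close> on \<open>E\<close>. Rows and columns are indexed by elements of \<open>E\<close> and the entry
  is \<open>lam (r * u)\<close>; this bilinear form is nondegenerate, so every \<open>K\<close>-basis of \<open>E\<close> is a covered
  set of columns (\<open>exists_linear_columns\<close>). There are \<open>\<Prod>i<t. q ^ t - q ^ i\<close> ordered bases.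
  Choosing the \<open>k\<close> columns independently and uniformly from the nonzero elements covers
  \<open>cov_const t q * (k choose t)\<close> sets on average (\<open>cov_max_ge_average\<close>). Using one vector on
  each of the \<open>(q ^ t - 1) / (q - 1)\<close> lines through the origin equally often makes every estimate
  of the upper bound sharp, and a count of the covered sets confirms that it is met
  (\<open>cov_max_ge_balanced\<close>).
\<close>

hide_const (open) Divisibility.prime

section \<open>The Lagrangian of a uniform hypergraph\<close>

text \<open>
  The Lagrangian polynomial of the hypergraph with edge set \<open>H\<close>: its value at the all-one weighting
  is the number of edges. It is affine in each variable, and the derivative along a vertex is
  the polynomial of the link of that vertex.
\<close>
definition edge_poly :: "'c set set \<Rightarrow> ('c \<Rightarrow> real) \<Rightarrow> real" where
  "edge_poly H x = (\<Sum>Q\<in>H. \<Prod>c\<in>Q. x c)"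

definition link :: "'c set set \<Rightarrow> 'c \<Rightarrow> 'c set set" where
  "link H c = (\<lambda>Q. Q - {c}) ` {Q \<in> H. c \<in> Q}"

definition deletion :: "'c set set \<Rightarrow> 'c \<Rightarrow> 'c set set" where
  "deletion H c = {Q \<in> H. c \<notin> Q}"

lemma link_eq: "link H c = {P. c \<notin> P \<and> insert c P \<in> H}"
proof (intro equalityI subsetI)
  fix P assume "P \<in> {P. c \<notin> P \<and> insert c P \<in> H}"
  then have "P = insert c P - {c}" "insert c P \<in> {Q \<in> H. c \<in> Q}" by auto
  then show "P \<in> link H c" unfolding link_def by blast
qed (auto simp: link_def insert_absorb)

lemma edge_poly_cong: "(\<And>c. c \<in> \<Union>H \<Longrightarrow> x c = y c) \<Longrightarrow> edge_poly H x = edge_poly H y"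
  unfolding edge_poly_def by (intro sum.cong prod.cong) auto

lemma edge_poly_nonneg: "(\<And>c. c \<in> \<Union>H \<Longrightarrow> 0 \<le> x c) \<Longrightarrow> 0 \<le> edge_poly H x"
  unfolding edge_poly_def by (intro sum_nonneg prod_nonneg) auto

lemma edge_poly_mono_edges:
  assumes "finite H'" "H \<subseteq> H'" "\<And>c. c \<in> \<Union>H' \<Longrightarrow> 0 \<le> x c"
  shows "edge_poly H x \<le> edge_poly H' x"
  unfolding edge_poly_def using assms by (intro sum_mono2 prod_nonneg) auto

lemma edge_poly_link: "edge_poly (link H c) x = (\<Sum>Q | Q \<in> H \<and> c \<in> Q. \<Prod>d\<in>Q - {c}. x d)"
proof -
  have "inj_on (\<lambda>Q. Q - {c}) {Q \<in> H. c \<in> Q}" by (rule inj_onI) blast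
  then show ?thesis unfolding edge_poly_def link_def by (simp add: sum.reindex)
qed

lemma edge_poly_split:
  assumes "finite H" "\<And>Q. Q \<in> H \<Longrightarrow> finite Q"
  shows "edge_poly H x = x c * edge_poly (link H c) x + edge_poly (deletion H c) x"
proof -
  have "edge_poly H x = (\<Sum>Q | Q \<in> H \<and> c \<in> Q. \<Prod>d\<in>Q. x d) + edge_poly (deletion H c) x"
    unfolding edge_poly_def deletion_def using assms(1)
    by (subst sum.union_disjoint[symmetric]) (auto intro: sum.cong)
  also have "(\<Sum>Q | Q \<in> H \<and> c \<in> Q. \<Prod>d\<in>Q. x d) = x c * edge_poly (link H c) x"
    unfolding edge_poly_link sum_distrib_left
    by (intro sum.cong refl) (use assms(2) in \<open>auto simp: prod.remove\<close>)
  finally show ?thesis .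
qed

lemma finite_link_deletion:
  assumes "finite H" "\<And>Q. Q \<in> H \<Longrightarrow> finite Q"
  shows "finite (link H c)" "\<And>Q. Q \<in> link H c \<Longrightarrow> finite Q"
    "finite (deletion H c)" "\<And>Q. Q \<in> deletion H c \<Longrightarrow> finite Q"
  using assms by (auto simp: link_def deletion_def)

text \<open>
  Moving weight \<open>\<delta>\<close> from \<open>c\<close> to \<open>d\<close> changes a polynomial that is affine in each variable by a
  quadratic in \<open>\<delta>\<close>, whose second-order coefficient counts only the edges through both vertices.
  If no edge contains both, the change is linear; this is the step behind the symmetrisation.
\<close>
lemma edge_poly_shift:
  assumes H: "finite H" "\<And>Q. Q \<in> H \<Longrightarrow> finite Q" and cd: "c \<noteq> d"
  shows "edge_poly H (x(c := x c - \<delta>, d := x d + \<delta>)) =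
    edge_poly H x + \<delta> * (edge_poly (link H d) x - edge_poly (link H c) x)
      - \<delta>\<^sup>2 * edge_poly (link (link H c) d) x"
proof -
  note fin = finite_link_deletion[OF H]
  have splitL: "edge_poly (link H e) z =
      z f * edge_poly (link (link H e) f) z + edge_poly (deletion (link H e) f) z" for e z f
    by (rule edge_poly_split[OF fin(1) fin(2)])
  have splitD: "edge_poly (deletion H e) z =
      z f * edge_poly (link (deletion H e) f) z + edge_poly (deletion (deletion H e) f) z" for e z f
    by (rule edge_poly_split[OF fin(3) fin(4)])
  let ?a = "edge_poly (link (link H c) d)" and ?b = "edge_poly (deletion (link H c) d)"
  let ?b' = "edge_poly (link (deletion H c) d)" and ?r = "edge_poly (deletion (deletion H c) d)"
  have expand: "edge_poly H z = z c * (z d * ?a z + ?b z) + (z d * ?b' z + ?r z)" for z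
    using edge_poly_split[OF H, of z c] splitL[of c z d] splitD[of c z d] by simp
  have Dc: "edge_poly (link H c) x = x d * ?a x + ?b x"
    by (rule splitL)
  have sym: "link (link H d) c = link (link H c) d" "deletion (link H d) c = link (deletion H c) d"
    using cd by (auto simp: link_eq deletion_def insert_commute)
  have Dd: "edge_poly (link H d) x = x c * ?a x + ?b' x"
    using splitL[of d x c] unfolding sym .
  let ?y = "x(c := x c - \<delta>, d := x d + \<delta>)"
  have same: "?a ?y = ?a x" "?b ?y = ?b x" "?b' ?y = ?b' x" "?r ?y = ?r x"
    by (rule edge_poly_cong; auto simp: link_eq deletion_def)+
  show ?thesis
    unfolding expand[of ?y] expand[of x] same Dc Dd using cd by (simp add: algebra_simps power2_eq_square)
qed

text \<open>
  Euler's identity for a homogeneous polynomial of degree \<open>t\<close>.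
\<close>
lemma edge_poly_euler:
  assumes V: "finite V" "H \<subseteq> Pow V" and t: "\<And>Q. Q \<in> H \<Longrightarrow> card Q = t"
  shows "(\<Sum>c\<in>V. x c * edge_poly (link H c) x) = real t * edge_poly H x"
proof -
  have H: "finite H" using V by (auto intro: finite_subset)
  have "(\<Sum>c\<in>V. x c * edge_poly (link H c) x) = (\<Sum>c\<in>V. \<Sum>Q | Q \<in> H \<and> c \<in> Q. \<Prod>d\<in>Q. x d)"
    unfolding edge_poly_link sum_distrib_left
  proof (intro sum.cong refl)
    fix c Q assume "Q \<in> {Q \<in> H. c \<in> Q}"
    then have "finite Q" "c \<in> Q" using V by (auto intro: finite_subset)
    then show "x c * (\<Prod>d\<in>Q - {c}. x d) = (\<Prod>d\<in>Q. x d)" by (simp add: prod.remove)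
  qed
  also have "\<dots> = (\<Sum>Q\<in>H. \<Sum>c | c \<in> V \<and> c \<in> Q. \<Prod>d\<in>Q. x d)"
    using V(1) H by (rule sum.swap_restrict)
  also have "\<dots> = (\<Sum>Q\<in>H. real t * (\<Prod>d\<in>Q. x d))"
  proof (intro sum.cong refl)
    fix Q assume "Q \<in> H"
    then have "{c. c \<in> V \<and> c \<in> Q} = Q" using V by auto
    then show "(\<Sum>c | c \<in> V \<and> c \<in> Q. \<Prod>d\<in>Q. x d) = real t * (\<Prod>d\<in>Q. x d)"
      using t[OF \<open>Q \<in> H\<close>] by simp
  qed
  finally show ?thesis unfolding edge_poly_def sum_distrib_left .
qed

text \<open>
  The standard simplex on \<open>V\<close>, with weightings extended by \<open>0\<close> outside \<open>V\<close> so that the product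
  topology on functions makes it compact.
\<close>
definition weightings :: "'c set \<Rightarrow> ('c \<Rightarrow> real) set" where
  "weightings V = {x. (\<forall>c. 0 \<le> x c) \<and> (\<forall>c. c \<notin> V \<longrightarrow> x c = 0) \<and> sum x V = 1}"

lemma compact_weightings:
  assumes "finite V" shows "compact (weightings V)"
proof -
  let ?B = "PiE UNIV (\<lambda>c. if c \<in> V then {0..1::real} else {0})"
  have "compactin (product_topology (\<lambda>_. euclidean) UNIV) ?B"
    by (subst compactin_PiE) auto
  then have B: "compact ?B"
    by (simp add: euclidean_product_topology)
  have cont: "continuous_on UNIV (\<lambda>x. \<Sum>c\<in>V. x c :: real)"
    by (intro continuous_intros continuous_on_product_coordinates)
  have cl: "closed {x. (\<Sum>c\<in>V. x c :: real) = 1}"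
    using continuous_closed_preimage_constant[OF cont closed_UNIV, of 1] by simp
  have "weightings V = ?B \<inter> {x. (\<Sum>c\<in>V. x c) = 1}"
  proof (intro equalityI subsetI)
    fix x assume x: "x \<in> weightings V"
    have "x c \<le> 1" if "c \<in> V" for c
      using member_le_sum[OF that, of x] x assms unfolding weightings_def by simp
    then show "x \<in> ?B \<inter> {x. (\<Sum>c\<in>V. x c) = 1}" using x unfolding weightings_def by (auto simp: PiE_iff)
  next
    fix x assume x: "x \<in> ?B \<inter> {x. (\<Sum>c\<in>V. x c) = 1}"
    then have "x c \<in> (if c \<in> V then {0..1::real} else {0})" for c by (auto simp: PiE_iff)
    then have "0 \<le> x c \<and> (c \<notin> V \<longrightarrow> x c = 0)" for c by (metis atLeastAtMost_iff order_refl singletonD)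
    then show "x \<in> weightings V" using x unfolding weightings_def by simp
  qed
  then show ?thesis using compact_Int_closed[OF B cl] by simp
qed

text \<open>
  The argument of Motzkin and Straus. A maximiser exists by compactness; pick one of minimal
  support. Weight cannot profitably be moved away from a vertex of positive weight, so all
  derivatives on the support are equal and largest, and Euler's identity evaluates them.
  If two vertices of the support lay in no common edge, all weight of one
  could be moved to the other without loss, contradicting minimality.
\<close>
lemma lagrangian_maximiser:
  assumes V: "finite V" "H \<subseteq> Pow V" and t: "\<And>Q. Q \<in> H \<Longrightarrow> card Q = t" and ne: "H \<noteq> {}" "t > 0"
  obtains x where "x \<in> weightings V" "\<And>y. y \<in> weightings V \<Longrightarrow> edge_poly H y \<le> edge_poly H x"
    "edge_poly H x > 0"
    "\<And>c d. x c > 0 \<Longrightarrow> x d > 0 \<Longrightarrow> c \<noteq> d \<Longrightarrow> \<exists>Q\<in>H. c \<in> Q \<and> d \<in> Q"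
    "\<And>c. x c > 0 \<Longrightarrow> real t * edge_poly H x \<le> edge_poly (link H c) x"
proof -
  have H: "finite H" "\<And>Q. Q \<in> H \<Longrightarrow> finite Q" using V by (auto intro: finite_subset)
  obtain Q0 where Q0: "Q0 \<in> H" using ne by auto
  have Vne: "V \<noteq> {}" using Q0 V t[OF Q0] ne(2) by force
  define u where "u = (\<lambda>c. if c \<in> V then 1 / real (card V) else 0)"
  have cV: "card V > 0" using V(1) Vne by (simp add: card_gt_0_iff)
  have u: "u \<in> weightings V" unfolding weightings_def u_def using cV by simp
  have u0: "edge_poly H u > 0"
    unfolding edge_poly_def using H Q0 V cV
    by (intro sum_pos2[OF _ Q0] prod_pos prod_nonneg) (auto simp: u_def)
  have "continuous_on (weightings V) (edge_poly H)"
    unfolding edge_poly_def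
    by (intro continuous_intros continuous_on_subset[OF continuous_on_product_coordinates]) auto
  then obtain x0 where x0: "x0 \<in> weightings V" "\<And>y. y \<in> weightings V \<Longrightarrow> edge_poly H y \<le> edge_poly H x0"
    using continuous_attains_sup[OF compact_weightings[OF V(1)]] u by blast
  define best where "best = (\<lambda>x. x \<in> weightings V \<and> (\<forall>y\<in>weightings V. edge_poly H y \<le> edge_poly H x))"
  obtain x where x: "best x" and xmin: "\<And>y. best y \<Longrightarrow> card {c. x c > 0} \<le> card {c. y c > 0}"
    using ex_has_least_nat[of best x0 "\<lambda>x. card {c. x c > 0}"] x0 unfolding best_def by blast
  have xw: "x \<in> weightings V" and xmax: "\<And>y. y \<in> weightings V \<Longrightarrow> edge_poly H y \<le> edge_poly H x"
    using x unfolding best_def by auto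
  have nn: "0 \<le> x c" for c using xw unfolding weightings_def by auto
  have supp: "c \<in> V" if "x c > 0" for c using xw that unfolding weightings_def by force
  have shift: "x(c := x c - \<delta>, d := x d + \<delta>) \<in> weightings V"
    if "c \<in> V" "d \<in> V" "c \<noteq> d" "0 \<le> \<delta>" "\<delta> \<le> x c" for c d \<delta>
  proof -
    have rem: "sum f V = f c + (f d + sum f (V - {c} - {d}))" for f :: "'a \<Rightarrow> real"
      using sum.remove[OF V(1) that(1), of f] sum.remove[of "V - {c}" d f] that V(1) by simp
    have "sum (x(c := x c - \<delta>, d := x d + \<delta>)) V =
      (x c - \<delta>) + ((x d + \<delta>) + sum (x(c := x c - \<delta>, d := x d + \<delta>)) (V - {c} - {d}))"
      using rem[of "x(c := x c - \<delta>, d := x d + \<delta>)"] that(3) by simp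
    also have "sum (x(c := x c - \<delta>, d := x d + \<delta>)) (V - {c} - {d}) = sum x (V - {c} - {d})"
      by (intro sum.cong) auto
    finally have "sum (x(c := x c - \<delta>, d := x d + \<delta>)) V = sum x V" using rem[of x] by linarith
    then show ?thesis using xw that unfolding weightings_def by auto
  qed
  have le: "edge_poly (link H d) x \<le> edge_poly (link H c) x" if c: "x c > 0" and d: "d \<in> V" for c d
  proof (rule ccontr)
    assume "\<not> ?thesis"
    then have D: "edge_poly (link H d) x - edge_poly (link H c) x > 0" (is "?D > 0") by simp
    then have cd: "c \<noteq> d" by auto
    let ?a = "edge_poly (link (link H c) d) x"
    have a: "0 \<le> ?a" using nn by (intro edge_poly_nonneg) auto
    \<comment> \<open>small enough for the linear gain to beat the quadratic loss\<close>
    define \<delta> where "\<delta> = min (x c) (?D / (?a + 1))"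
    have \<delta>: "0 < \<delta>" "\<delta> \<le> x c" unfolding \<delta>_def using c D a by auto
    have "\<delta> * ?a < \<delta> * (?a + 1)" using \<delta> by simp
    also have "\<delta> * (?a + 1) \<le> ?D / (?a + 1) * (?a + 1)"
      unfolding \<delta>_def using a by (intro mult_right_mono) auto
    also have "\<dots> = ?D" using a by simp
    finally have "\<delta> * (\<delta> * ?a) < \<delta> * ?D" using \<delta>(1) by simp
    then have "edge_poly H x < edge_poly H (x(c := x c - \<delta>, d := x d + \<delta>))"
      using edge_poly_shift[OF H cd, of x \<delta>] by (simp only: power2_eq_square mult.assoc)
    moreover have "x(c := x c - \<delta>, d := x d + \<delta>) \<in> weightings V"
      using shift supp[OF c] d cd \<delta> by simp
    ultimately show False using xmax by force
  qed
  show thesis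
  proof (rule that[OF xw xmax])
    show "edge_poly H x > 0" using u0 xmax[OF u] by simp
    show "\<exists>Q\<in>H. c \<in> Q \<and> d \<in> Q" if c: "x c > 0" and d: "x d > 0" and cd: "c \<noteq> d" for c d
    proof (rule ccontr)
      assume no: "\<not> ?thesis"
      let ?y = "x(c := x c - x c, d := x d + x c)"
      have "link (link H c) d = {}" using no by (auto simp: link_eq)
      then have "edge_poly (link (link H c) d) x = 0" by (simp add: edge_poly_def)
      moreover have "edge_poly (link H d) x = edge_poly (link H c) x"
        using le[OF c supp[OF d]] le[OF d supp[OF c]] by simp
      ultimately have "edge_poly H ?y = edge_poly H x"
        using edge_poly_shift[OF H cd, of x "x c"] by simp
      moreover have "?y \<in> weightings V" using nn by (intro shift supp c d cd) simp_all
      ultimately have "best ?y" unfolding best_def using xmax by simp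
      then have "card {e. x e > 0} \<le> card {e. ?y e > 0}" by (rule xmin)
      moreover have "{e. ?y e > 0} \<subset> {e. x e > 0}" using c d cd by (auto simp: fun_upd_apply split: if_splits)
      moreover have "finite {e. x e > 0}" using supp V(1) by (auto intro: finite_subset)
      ultimately show False using psubset_card_mono by (metis not_less)
    qed
    show "real t * edge_poly H x \<le> edge_poly (link H c) x" if c: "x c > 0" for c
    proof -
      have "real t * edge_poly H x = (\<Sum>d\<in>V. x d * edge_poly (link H d) x)"
        using edge_poly_euler[OF V t, where x=x] by simp
      also have "\<dots> \<le> (\<Sum>d\<in>V. x d * edge_poly (link H c) x)"
        using le[OF c] nn by (intro sum_mono mult_left_mono) auto
      also have "\<dots> = edge_poly (link H c) x"
        using xw unfolding weightings_def by (simp flip: sum_distrib_right)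
      finally show ?thesis .
    qed
  qed
qed

section \<open>Pairwise balanced columns\<close>

text \<open>
  The bound of Plackett and Burman for orthogonal arrays of strength two, by counting: fix a row \<open>r0\<close>
  and let \<open>g r\<close> be the number of columns in which row \<open>r\<close> agrees with \<open>r0\<close>. Balance determines the
  first two moments of \<open>g\<close> over all rows. Taking out \<open>r0\<close> itself, where \<open>g\<close> is as large as possible, the
  Cauchy-Schwarz inequality on the other rows becomes the claim.
\<close>
lemma plackett_burman:
  fixes A :: "'r \<Rightarrow> 'c \<Rightarrow> 's" and v :: nat
  assumes R: "finite R" "R \<noteq> {}" and C: "finite C" and v: "v \<ge> 1"
    and single: "\<And>c r0. c \<in> C \<Longrightarrow> r0 \<in> R \<Longrightarrow> card {r \<in> R. A r c = A r0 c} * v = card R"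
    and pairs: "\<And>c d r0. c \<in> C \<Longrightarrow> d \<in> C \<Longrightarrow> c \<noteq> d \<Longrightarrow> r0 \<in> R \<Longrightarrow>
      card {r \<in> R. A r c = A r0 c \<and> A r d = A r0 d} * v\<^sup>2 = card R"
  shows "real (card C) * (real v - 1) \<le> real (card R) - 1"
proof (cases "C = {}")
  case True
  have "card R > 0" using R by (simp add: card_gt_0_iff)
  then show ?thesis using True by simp
next
  case False
  then have m: "real (card C) > 0" (is "?m > 0") using C by (simp add: card_gt_0_iff)
  obtain r0 where r0: "r0 \<in> R" using R by auto
  define N where "N = real (card R)"
  define L where "L = N / real v"
  have N: "N > 0" using R unfolding N_def by (simp add: card_gt_0_iff)
  have v0: "real v > 0" using v by simp
  have L: "L > 0" "N = real v * L" using N v0 unfolding L_def by auto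
  define g where "g = (\<lambda>r. \<Sum>c\<in>C. of_bool (A r c = A r0 c) :: real)"
  have count: "(\<Sum>r\<in>R. of_bool (P r) :: real) = real (card {r \<in> R. P r})" for P
    using R(1) by (simp add: Collect_conj_eq)
  have cs: "(\<Sum>r\<in>R. of_bool (A r c = A r0 c) :: real) = L" if "c \<in> C" for c
  proof -
    have "real (card {r \<in> R. A r c = A r0 c}) * real v = N"
      unfolding N_def single[OF that r0, symmetric] by simp
    then show ?thesis unfolding L_def count using v0 by (simp add: field_simps)
  qed
  have ps: "(\<Sum>r\<in>R. of_bool (A r c = A r0 c) * of_bool (A r d = A r0 d) :: real) = L / real v"
    if "c \<in> C" "d \<in> C" "c \<noteq> d" for c d
  proof -
    have "real (card {r \<in> R. A r c = A r0 c \<and> A r d = A r0 d}) * (real v)\<^sup>2 = N"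
      unfolding N_def pairs[OF that r0, symmetric] by simp
    then show ?thesis
      unfolding L_def of_bool_conj[symmetric] count using v0
      by (simp add: field_simps power2_eq_square)
  qed
  have g0: "g r0 = ?m" unfolding g_def by simp
  have S1: "(\<Sum>r\<in>R. g r) = ?m * L"
    unfolding g_def by (subst sum.swap) (simp add: cs)
  have "(\<Sum>r\<in>R. (g r)\<^sup>2) = (\<Sum>c\<in>C. \<Sum>d\<in>C. \<Sum>r\<in>R. of_bool (A r c = A r0 c) * of_bool (A r d = A r0 d))"
    unfolding g_def power2_eq_square sum_product
    by (subst sum.swap) (intro sum.cong refl sum.swap)
  also have "\<dots> = (\<Sum>c\<in>C. L + (?m - 1) * (L / real v))"
  proof (intro sum.cong refl)
    fix c assume c: "c \<in> C"
    have "(\<Sum>d\<in>C. \<Sum>r\<in>R. of_bool (A r c = A r0 c) * of_bool (A r d = A r0 d) :: real)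
      = (\<Sum>r\<in>R. of_bool (A r c = A r0 c) * of_bool (A r c = A r0 c))
        + (\<Sum>d\<in>C - {c}. \<Sum>r\<in>R. of_bool (A r c = A r0 c) * of_bool (A r d = A r0 d))"
      using C c by (rule sum.remove)
    also have "(\<Sum>r\<in>R. of_bool (A r c = A r0 c) * of_bool (A r c = A r0 c) :: real) = L"
      using cs[OF c] unfolding of_bool_conj[symmetric] by simp
    also have "(\<Sum>d\<in>C - {c}. \<Sum>r\<in>R. of_bool (A r c = A r0 c) * of_bool (A r d = A r0 d) :: real)
      = (\<Sum>d\<in>C - {c}. L / real v)" using ps[OF c] by (intro sum.cong) auto
    also have "\<dots> = (?m - 1) * (L / real v)"
      using c C m by (simp add: card_Diff_singleton of_nat_diff Suc_leI)
    finally show "(\<Sum>d\<in>C. \<Sum>r\<in>R. of_bool (A r c = A r0 c) * of_bool (A r d = A r0 d) :: real)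
      = L + (?m - 1) * (L / real v)" .
  qed
  finally have S2: "(\<Sum>r\<in>R. (g r)\<^sup>2) = ?m * (L + (?m - 1) * (L / real v))" by simp
  have "(\<Sum>r\<in>R - {r0}. g r)\<^sup>2 \<le> (\<Sum>r\<in>R - {r0}. (g r)\<^sup>2) * real (card (R - {r0}))"
    by (rule sum_squared_le_sum_of_squares)
  moreover have "(\<Sum>r\<in>R - {r0}. g r) = ?m * L - ?m"
    using sum.remove[OF R(1) r0, of g] S1 g0 by simp
  moreover have "(\<Sum>r\<in>R - {r0}. (g r)\<^sup>2) = ?m * (L + (?m - 1) * (L / real v)) - ?m\<^sup>2"
    using sum.remove[OF R(1) r0, of "\<lambda>r. (g r)\<^sup>2"] S2 g0 by simp
  moreover have "real (card (R - {r0})) = N - 1"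
    using R r0 N unfolding N_def by (simp add: card_Diff_singleton of_nat_diff Suc_leI)
  ultimately have "(?m * L - ?m)\<^sup>2 \<le> (?m * (L + (?m - 1) * (L / real v)) - ?m\<^sup>2) * (N - 1)" by simp
  also have "(?m * L - ?m)\<^sup>2 = ?m * (?m * (L - 1)\<^sup>2)" by (simp add: power2_eq_square algebra_simps)
  also have "(?m * (L + (?m - 1) * (L / real v)) - ?m\<^sup>2) * (N - 1)
    = ?m * ((L + (?m - 1) * (L / real v) - ?m) * (N - 1))" by (simp add: power2_eq_square algebra_simps)
  finally have "?m * (L - 1)\<^sup>2 \<le> (L + (?m - 1) * (L / real v) - ?m) * (N - 1)" using m by simp
  moreover have "(L + (?m - 1) * (L / real v) - ?m) * (N - 1) - ?m * (L - 1)\<^sup>2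
    = L * ((real v - 1) / real v) * ((N - 1) - ?m * (real v - 1))"
    unfolding L(2) using v0 by (simp add: field_simps power2_eq_square)
  ultimately have ge: "0 \<le> L * ((real v - 1) / real v) * ((N - 1) - ?m * (real v - 1))" by linarith
  show ?thesis
  proof (cases "v = 1")
    case True
    have "card R > 0" using R by (simp add: card_gt_0_iff)
    then show ?thesis using True by simp
  next
    case False
    then have "L * ((real v - 1) / real v) > 0" using L v by simp
    then have "0 \<le> (N - 1) - ?m * (real v - 1)"
      using ge mult_pos_neg[of "L * ((real v - 1) / real v)" "(N - 1) - ?m * (real v - 1)"] by linarith
    then show ?thesis unfolding N_def by simp
  qed
qed

section \<open>The upper bound\<close>

lemma card_PiE_prescribed:
  assumes Q: "finite Q" and T: "T \<subseteq> Q" and g: "\<And>c. c \<in> T \<Longrightarrow> g c \<in> S"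
  shows "card {f \<in> Q \<rightarrow>\<^sub>E S. \<forall>c\<in>T. f c = g c} * card S ^ card T = card S ^ card Q"
proof -
  have "{f \<in> Q \<rightarrow>\<^sub>E S. \<forall>c\<in>T. f c = g c} = PiE Q (\<lambda>c. if c \<in> T then {g c} else S)"
  proof (intro equalityI subsetI)
    fix f assume f: "f \<in> PiE Q (\<lambda>c. if c \<in> T then {g c} else S)"
    then have fc: "f c \<in> (if c \<in> T then {g c} else S)" if "c \<in> Q" for c using that by (auto simp: PiE_iff)
    have "f c = g c" if "c \<in> T" for c using fc[of c] that T by auto
    moreover have "f c \<in> S" if "c \<in> Q" for c using fc[OF that] g[of c] by (cases "c \<in> T") auto
    ultimately show "f \<in> {f \<in> Q \<rightarrow>\<^sub>E S. \<forall>c\<in>T. f c = g c}" using f by (auto simp: PiE_iff)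
  qed (use T in \<open>auto simp: PiE_iff\<close>)
  then have "card {f \<in> Q \<rightarrow>\<^sub>E S. \<forall>c\<in>T. f c = g c} = (\<Prod>c\<in>Q. card (if c \<in> T then {g c} else S))"
    using card_PiE[OF Q] by simp
  also have "\<dots> = (\<Prod>c\<in>Q - T. card (if c \<in> T then {g c} else S))"
    by (rule prod.mono_neutral_right) (use Q in auto)
  also have "\<dots> = (\<Prod>c\<in>Q - T. card S)" by (intro prod.cong) auto
  also have "\<dots> = card S ^ (card Q - card T)"
    using T finite_subset[OF T Q] by (simp add: card_Diff_subset)
  finally show ?thesis
    using card_mono[OF Q T] by (simp flip: power_add)
qed

text \<open>
  For \<open>card S ^ t\<close> rows with entries in \<open>S\<close> this is the same as being covered, but unlike covering it
  passes to links without any reference to the symbols that occur.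
\<close>
definition separating_sets :: "'r set \<Rightarrow> ('r \<Rightarrow> 'c \<Rightarrow> 's) \<Rightarrow> 'c set \<Rightarrow> nat \<Rightarrow> 'c set set" where
  "separating_sets R A V t = {Q. Q \<subseteq> V \<and> card Q = t \<and> inj_on (\<lambda>r. restrict (A r) Q) R}"

text \<open>
  On a separating set of the right size the rows are in bijection with all patterns, so
  prescribing the entries in some of its columns leaves the expected number of rows.
\<close>
lemma balanced:
  assumes S: "finite S" "S \<noteq> {}" and R: "card R = card S ^ card Q" and Q: "finite Q"
    and A: "\<And>r c. r \<in> R \<Longrightarrow> c \<in> Q \<Longrightarrow> A r c \<in> S"
    and inj: "inj_on (\<lambda>r. restrict (A r) Q) R"
    and T: "T \<subseteq> Q" and g: "\<And>c. c \<in> T \<Longrightarrow> g c \<in> S"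
  shows "card {r \<in> R. \<forall>c\<in>T. A r c = g c} * card S ^ card T = card R"
proof -
  let ?f = "\<lambda>r. restrict (A r) Q"
  have "?f ` R \<subseteq> Q \<rightarrow>\<^sub>E S" using A by auto
  moreover have "card (?f ` R) = card (Q \<rightarrow>\<^sub>E S)"
    using card_image[OF inj] R Q by (simp add: card_funcsetE)
  ultimately have onto: "?f ` R = Q \<rightarrow>\<^sub>E S"
    by (rule card_subset_eq[OF finite_PiE[OF Q S(1)]])
  have "?f ` {r \<in> R. \<forall>c\<in>T. A r c = g c} = {f \<in> Q \<rightarrow>\<^sub>E S. \<forall>c\<in>T. f c = g c}"
  proof (intro equalityI subsetI)
    fix f assume f: "f \<in> {f \<in> Q \<rightarrow>\<^sub>E S. \<forall>c\<in>T. f c = g c}"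
    then obtain r where r: "r \<in> R" "f = ?f r" using onto by blast
    have "A r c = g c" if "c \<in> T" for c
    proof -
      have "f c = g c" "c \<in> Q" using f that T by auto
      then show ?thesis unfolding r(2) by simp
    qed
    then show "f \<in> ?f ` {r \<in> R. \<forall>c\<in>T. A r c = g c}" using r by blast
  next
    fix f assume "f \<in> ?f ` {r \<in> R. \<forall>c\<in>T. A r c = g c}"
    then obtain r where r: "r \<in> R" "\<forall>c\<in>T. A r c = g c" "f = ?f r" by blast
    have "f \<in> Q \<rightarrow>\<^sub>E S" using onto r by blast
    then show "f \<in> {f \<in> Q \<rightarrow>\<^sub>E S. \<forall>c\<in>T. f c = g c}" using r T by auto
  qed
  then have "card {f \<in> Q \<rightarrow>\<^sub>E S. \<forall>c\<in>T. f c = g c} = card {r \<in> R. \<forall>c\<in>T. A r c = g c}"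
    using card_image[OF inj_on_subset[OF inj], of "{r \<in> R. \<forall>c\<in>T. A r c = g c}"] by auto
  then show ?thesis using card_PiE_prescribed[OF Q T, of g S] g R by simp
qed

lemma cov_const_nonneg: "v \<ge> 1 \<Longrightarrow> 0 \<le> cov_const t v"
  unfolding cov_const_def
  by (intro prod_nonneg divide_nonneg_nonneg) (simp_all add: power_increasing)

text \<open>
  The factor is the share of the weight that remains when one of \<open>(v ^ Suc t - 1) / (v - 1)\<close>
  equally weighted columns is removed, once for each further column of the set.
\<close>
lemma cov_const_Suc:
  assumes v: "v \<ge> 2"
  shows "cov_const (Suc t) v =
    cov_const t v * ((real v ^ Suc t - real v) / (real v ^ Suc t - 1)) ^ t"
proof (cases "t = 0")
  case True
  then show ?thesis using v by (simp add: cov_const_def)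
next
  case False
  define w where "w = real v"
  have w: "w > 1" using v unfolding w_def by simp
  have n0: "w ^ t - 1 \<noteq> 0" "w ^ Suc t - 1 \<noteq> 0"
    using one_less_power[OF w, of t] one_less_power[OF w, of "Suc t"] False by auto
  have scale: "w * a / c = a / b * (w * b / c)" if "b \<noteq> 0" for a b c :: real
    using that by simp
  have "cov_const (Suc t) v = (\<Prod>i<t. (w ^ Suc t - w ^ Suc i) / (w ^ Suc t - 1))"
    unfolding cov_const_def w_def[symmetric] prod.lessThan_Suc_shift using n0 by simp
  also have "\<dots> = (\<Prod>i<t. (w ^ t - w ^ i) / (w ^ t - 1) * ((w ^ Suc t - w) / (w ^ Suc t - 1)))"
  proof (intro prod.cong refl)
    fix i
    have "w ^ Suc t - w ^ Suc i = w * (w ^ t - w ^ i)" "w ^ Suc t - w = w * (w ^ t - 1)"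
      by (simp_all add: algebra_simps)
    then show "(w ^ Suc t - w ^ Suc i) / (w ^ Suc t - 1) =
        (w ^ t - w ^ i) / (w ^ t - 1) * ((w ^ Suc t - w) / (w ^ Suc t - 1))"
      by (simp only: scale[OF n0(1), symmetric])
  qed
  also have "\<dots> = cov_const t v * ((w ^ Suc t - w) / (w ^ Suc t - 1)) ^ t"
    unfolding prod.distrib cov_const_def w_def by simp
  finally show ?thesis unfolding w_def .
qed

text \<open>
  Induction on \<open>t\<close> over all weightings at once. The homogeneous form is what the step
  consumes, since the weights left after removing a column sum to \<open>1 - x c\<close>. A column \<open>c\<close> of
  at least average weight in the support of a maximiser is removed, and the rows are cut down to those with the
  symbol of some row \<open>r0\<close> in column \<open>c\<close>: on these, \<open>c\<close> no longer separates anything, so the remaining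
  columns of an edge through \<open>c\<close> must.
\<close>
theorem edge_poly_separating_sets_le:
  fixes A :: "'r \<Rightarrow> 'c \<Rightarrow> 's"
  assumes S: "finite S" "card S = v" and v: "v \<ge> 2"
  shows "finite V \<Longrightarrow> card R = v ^ t \<Longrightarrow> (\<And>r c. r \<in> R \<Longrightarrow> c \<in> V \<Longrightarrow> A r c \<in> S) \<Longrightarrow>
    (\<And>c. c \<in> V \<Longrightarrow> 0 \<le> y c) \<Longrightarrow>
    edge_poly (separating_sets R A V t) y \<le> cov_const t v / fact t * (sum y V) ^ t"
proof (induction t arbitrary: R V y)
  case 0
  have "separating_sets R A V 0 \<subseteq> {{}}"
    using 0 by (auto simp: separating_sets_def dest: finite_subset)
  then have "edge_poly (separating_sets R A V 0) y \<le> edge_poly {{}} y"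
    by (intro edge_poly_mono_edges) auto
  then show ?case by (simp add: edge_poly_def cov_const_def)
next
  case (Suc t)
  define H where "H = separating_sets R A V (Suc t)"
  define \<kappa> where "\<kappa> = cov_const (Suc t) v / fact (Suc t)"
  have \<kappa>0: "\<kappa> \<ge> 0" unfolding \<kappa>_def using cov_const_nonneg v by simp
  have Sne: "S \<noteq> {}" using S v by auto
  have R: "finite R" "R \<noteq> {}" using Suc.prems(2) v by (auto intro!: card_ge_0_finite)
  have H: "H \<subseteq> Pow V" "\<And>Q. Q \<in> H \<Longrightarrow> card Q = Suc t" unfolding H_def separating_sets_def by auto
  have finQ: "finite Q" if "Q \<in> H" for Q using H(1) Suc.prems(1) that by (auto intro: finite_subset)
  have bal: "card {r \<in> R. \<forall>c\<in>T. A r c = g c} * v ^ card T = v ^ Suc t"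
    if "Q \<in> H" "T \<subseteq> Q" "\<And>c. c \<in> T \<Longrightarrow> g c \<in> S" for Q T g
  proof -
    have Q: "Q \<subseteq> V" "inj_on (\<lambda>r. restrict (A r) Q) R" using that(1) unfolding H_def separating_sets_def by auto
    have "card R = card S ^ card Q" unfolding Suc.prems(2) S(2) H(2)[OF that(1)] ..
    moreover have "A r c \<in> S" if "r \<in> R" "c \<in> Q" for r c using Suc.prems(3) that Q(1) by auto
    ultimately have "card {r \<in> R. \<forall>c\<in>T. A r c = g c} * card S ^ card T = card R"
      by (rule balanced[OF S(1) Sne _ finQ[OF that(1)] _ Q(2) that(2,3)])
    then show ?thesis unfolding S(2) Suc.prems(2) .
  qed
  have norm: "edge_poly H z \<le> \<kappa>" if z: "z \<in> weightings V" for z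
  proof (cases "H = {}")
    case True
    then show ?thesis using \<kappa>0 by (simp add: edge_poly_def)
  next
    case False
    then obtain x where x: "x \<in> weightings V" "\<And>y. y \<in> weightings V \<Longrightarrow> edge_poly H y \<le> edge_poly H x"
      "edge_poly H x > 0"
      "\<And>c d. x c > 0 \<Longrightarrow> x d > 0 \<Longrightarrow> c \<noteq> d \<Longrightarrow> \<exists>Q\<in>H. c \<in> Q \<and> d \<in> Q"
      "\<And>c. x c > 0 \<Longrightarrow> real (Suc t) * edge_poly H x \<le> edge_poly (link H c) x"
      using lagrangian_maximiser[OF Suc.prems(1) H False zero_less_Suc] by metis
    define C where "C = {c. x c > 0}"
    have nn: "0 \<le> x c" for c using x(1) unfolding weightings_def by simp
    have CV: "C \<subseteq> V" using x(1) unfolding C_def weightings_def by force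
    then have finC: "finite C" using Suc.prems(1) finite_subset by blast
    have sumC: "sum x C = 1"
    proof -
      have "sum x V = sum x C"
        using nn by (intro sum.mono_neutral_right Suc.prems(1) CV) (auto simp: C_def order.antisym not_less)
      then show ?thesis using x(1) unfolding weightings_def by simp
    qed
    then have Cne: "C \<noteq> {}" by auto
    have edge: "\<exists>Q\<in>H. c \<in> Q" if "c \<in> C" for c
    proof (rule ccontr)
      assume "\<not> ?thesis"
      then have "link H c = {}" unfolding link_def by auto
      then have "edge_poly (link H c) x = 0" by (simp add: edge_poly_def)
      moreover have "real (Suc t) * edge_poly H x > 0" using x(3) by simp
      ultimately show False using x(5)[of c] that unfolding C_def by auto
    qed
    have m: "real (card C) * (real v - 1) \<le> real (card R) - 1"
    proof (rule plackett_burman[OF R finC])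
      show "v \<ge> 1" using v by simp
      fix c r0 assume c: "c \<in> C" and r0: "r0 \<in> R"
      then have AS: "A r0 c' \<in> S" if "c' \<in> C" for c' using Suc.prems(3) CV that by blast
      obtain Q where Q: "Q \<in> H" "c \<in> Q" using edge[OF c] by auto
      show "card {r \<in> R. A r c = A r0 c} * v = card R"
        using bal[OF Q(1), of "{c}" "A r0"] Q(2) AS[OF c] Suc.prems(2) by simp
      fix d assume d: "d \<in> C" and cd: "c \<noteq> d"
      obtain Q where Q: "Q \<in> H" "c \<in> Q" "d \<in> Q" using x(4)[of c d] c d cd unfolding C_def by auto
      show "card {r \<in> R. A r c = A r0 c \<and> A r d = A r0 d} * v\<^sup>2 = card R"
        using bal[OF Q(1), of "{c, d}" "A r0"] Q(2,3) AS[OF c] AS[OF d] Suc.prems(2) cd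
        by (auto simp: power2_eq_square)
    qed
    \<comment> \<open>a column of at least average weight\<close>
    obtain c where c: "c \<in> C" and big: "x c * real (card C) \<ge> 1"
    proof -
      have "\<exists>c\<in>C. x c * real (card C) \<ge> 1"
      proof (rule ccontr)
        assume "\<not> ?thesis"
        then have "(\<Sum>c\<in>C. x c * real (card C)) < (\<Sum>c\<in>C. 1)"
          using finC Cne by (intro sum_strict_mono) auto
        then show False using sumC by (simp flip: sum_distrib_right)
      qed
      then show thesis using that by auto
    qed
    define w where "w = real v"
    have w: "w > 1" using v unfolding w_def by simp
    have wN: "w ^ Suc t - 1 > 0" using one_less_power[OF w, of "Suc t"] by simp
    have xc: "1 - x c \<le> (w ^ Suc t - w) / (w ^ Suc t - 1)"
    proof -
      have "real (card C) * (w - 1) \<le> w ^ Suc t - 1" using m Suc.prems(2) unfolding w_def by simp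
      then have "x c * (real (card C) * (w - 1)) \<le> x c * (w ^ Suc t - 1)" using nn by (intro mult_left_mono)
      moreover have "1 * (w - 1) \<le> x c * real (card C) * (w - 1)" using big w by (intro mult_right_mono) auto
      ultimately have "w - 1 \<le> x c * (w ^ Suc t - 1)" by (simp add: mult.assoc)
      moreover have "(1 - x c) * (w ^ Suc t - 1) = (w ^ Suc t - 1) - x c * (w ^ Suc t - 1)"
        by (simp only: left_diff_distrib mult_1_left)
      ultimately have "(1 - x c) * (w ^ Suc t - 1) \<le> w ^ Suc t - w" by linarith
      then show ?thesis unfolding pos_le_divide_eq[OF wN] .
    qed
    have x1: "0 \<le> 1 - x c" using member_le_sum[OF c, of x] nn finC sumC by simp
    obtain r0 where r0: "r0 \<in> R" using R by auto
    have cV: "c \<in> V" using c CV by auto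
    define R' where "R' = {r \<in> R. A r c = A r0 c}"
    obtain Q where Q: "Q \<in> H" "c \<in> Q" using edge[OF c] by auto
    have "card R' * v = v ^ Suc t"
      using bal[OF Q(1), of "{c}" "A r0"] Q(2) Suc.prems(3)[OF r0 cV] unfolding R'_def by simp
    then have R': "card R' = v ^ t" using v by simp
    have sub: "link H c \<subseteq> separating_sets R' A (V - {c}) t"
    proof
      fix P assume "P \<in> link H c"
      then have P: "c \<notin> P" "insert c P \<in> H" unfolding link_eq by auto
      have fP: "finite P" using finQ[OF P(2)] by simp
      have "P \<subseteq> V - {c}" "card P = t" using P H(1) H(2)[OF P(2)] fP by auto
      moreover have "inj_on (\<lambda>r. restrict (A r) P) R'"
      proof (rule inj_onI)
        fix r s assume rs: "r \<in> R'" "s \<in> R'" "restrict (A r) P = restrict (A s) P"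
        have "A r d = A s d" if "d \<in> P" for d using fun_cong[OF rs(3), of d] that by simp
        then have "restrict (A r) (insert c P) = restrict (A s) (insert c P)"
          using rs(1,2) unfolding R'_def by (intro restrict_ext) auto
        moreover have "inj_on (\<lambda>r. restrict (A r) (insert c P)) R"
          using P(2) unfolding H_def separating_sets_def by auto
        ultimately show "r = s" using rs(1,2) unfolding R'_def by (auto dest: inj_onD)
      qed
      ultimately show "P \<in> separating_sets R' A (V - {c}) t" unfolding separating_sets_def by auto
    qed
    have "finite (separating_sets R' A (V - {c}) t)"
      by (rule finite_subset[of _ "Pow V"]) (use Suc.prems(1) in \<open>auto simp: separating_sets_def\<close>)
    then have "edge_poly (link H c) x \<le> edge_poly (separating_sets R' A (V - {c}) t) x"
      using sub nn by (intro edge_poly_mono_edges) auto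
    also have "\<dots> \<le> cov_const t v / fact t * (sum x (V - {c})) ^ t"
      using Suc.prems(1,3) R' nn unfolding R'_def by (intro Suc.IH) auto
    also have "sum x (V - {c}) = 1 - x c"
      using sum.remove[OF Suc.prems(1) cV, of x] x(1) unfolding weightings_def by simp
    also have "cov_const t v / fact t * (1 - x c) ^ t
        \<le> cov_const t v / fact t * ((w ^ Suc t - w) / (w ^ Suc t - 1)) ^ t"
      using x1 xc cov_const_nonneg[of v t] v by (intro mult_left_mono power_mono) auto
    also have "\<dots> = cov_const (Suc t) v / fact t"
      unfolding cov_const_Suc[OF v] w_def by simp
    also have "\<dots> = real (Suc t) * \<kappa>" unfolding \<kappa>_def by (simp add: divide_simps)
    finally have "edge_poly (link H c) x \<le> real (Suc t) * \<kappa>" .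
    moreover have "x c > 0" using c unfolding C_def by simp
    ultimately have "real (Suc t) * edge_poly H x \<le> real (Suc t) * \<kappa>"
      using order_trans[OF x(5)] by blast
    then have "edge_poly H x \<le> \<kappa>" by (rule mult_left_le_imp_le) simp
    then show ?thesis using x(2)[OF z] by simp
  qed
  define \<sigma> where "\<sigma> = sum y V"
  have \<sigma>0: "\<sigma> \<ge> 0" unfolding \<sigma>_def using Suc.prems(4) by (intro sum_nonneg)
  show ?case
  proof (cases "\<sigma> = 0")
    case True
    then have y0: "y c = 0" if "c \<in> V" for c
      using that sum_nonneg_eq_0_iff[OF Suc.prems(1), of y] Suc.prems(4) unfolding \<sigma>_def by auto
    have "(\<Prod>c\<in>Q. y c) = 0" if "Q \<in> H" for Q
    proof -
      have "Q \<noteq> {}" using H(2)[OF that] by auto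
      then show ?thesis using y0 H(1) that finQ[OF that] by (auto intro!: prod_zero)
    qed
    then have "edge_poly H y = 0" unfolding edge_poly_def by simp
    then show ?thesis using True unfolding H_def \<sigma>_def by simp
  next
    case False
    then have \<sigma>: "\<sigma> > 0" using \<sigma>0 by simp
    define z where "z = (\<lambda>c. if c \<in> V then y c / \<sigma> else 0)"
    have "sum z V = (\<Sum>c\<in>V. y c / \<sigma>)" unfolding z_def by (intro sum.cong) auto
    also have "\<dots> = 1" using \<sigma> unfolding \<sigma>_def by (simp flip: sum_divide_distrib)
    finally have zw: "z \<in> weightings V" unfolding weightings_def z_def using \<sigma> Suc.prems(4) by auto
    have "(\<Prod>c\<in>Q. z c) = (\<Prod>c\<in>Q. y c) / \<sigma> ^ Suc t" if Q: "Q \<in> H" for Q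
    proof -
      have "(\<Prod>c\<in>Q. z c) = (\<Prod>c\<in>Q. y c / \<sigma>)"
        using H(1) Q unfolding z_def by (intro prod.cong) auto
      also have "\<dots> = (\<Prod>c\<in>Q. y c) / \<sigma> ^ Suc t"
        by (simp only: prod_dividef prod_constant H(2)[OF Q])
      finally show ?thesis .
    qed
    then have "edge_poly H z = edge_poly H y / \<sigma> ^ Suc t"
      unfolding edge_poly_def sum_divide_distrib by (rule sum.cong[OF refl])
    then have "edge_poly H y / \<sigma> ^ Suc t \<le> \<kappa>" using norm[OF zw] by simp
    then have "edge_poly H y \<le> \<kappa> * \<sigma> ^ Suc t"
      by (rule iffD1[OF pos_divide_le_eq[OF zero_less_power[OF \<sigma>]]])
    then show ?thesis unfolding H_def \<sigma>_def \<kappa>_def .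
  qed
qed

text \<open>
  A surjection from the rows onto the equally many patterns is injective.
\<close>
lemma covers_imp_separating:
  assumes S: "finite S" and Q: "finite Q" and cov: "covers (card S ^ card Q) S A Q"
  shows "inj_on (\<lambda>i. restrict (A i) Q) {..<card S ^ card Q}"
proof -
  let ?N = "card S ^ card Q" and ?L = "{xs. set xs \<subseteq> S \<and> length xs = card Q}"
  have "?L \<subseteq> subarray_row A Q ` {..<?N}"
  proof
    fix xs assume "xs \<in> ?L"
    then have "\<exists>i<?N. subarray_row A Q i = xs" using cov unfolding covers_def by blast
    then show "xs \<in> subarray_row A Q ` {..<?N}" by blast
  qed
  then have "card ?L \<le> card (subarray_row A Q ` {..<?N})" by (rule card_mono[rotated]) (rule finite_imageI, rule finite_lessThan)
  then have "card {..<?N} \<le> card (subarray_row A Q ` {..<?N})"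
    unfolding card_lists_length_eq[OF S] card_lessThan .
  then have "card (subarray_row A Q ` {..<?N}) = card {..<?N}"
    by (rule le_antisym[OF card_image_le[OF finite_lessThan]])
  then have inj: "inj_on (subarray_row A Q) {..<?N}"
    by (intro eq_card_imp_inj_on) simp_all
  show ?thesis
  proof (rule inj_onI)
    fix i j assume ij: "i \<in> {..<?N}" "j \<in> {..<?N}" "restrict (A i) Q = restrict (A j) Q"
    have "A i c = A j c" if "c \<in> Q" for c using fun_cong[OF ij(3), of c] that by simp
    then have "subarray_row A Q i = subarray_row A Q j" unfolding subarray_row_def using Q by simp
    then show "i = j" using inj ij by (auto dest: inj_onD)
  qed
qed

theorem cov_upper_bound:
  assumes S: "finite S" "card S = v" and v: "v \<ge> 2" and t: "t > 0" and A: "A \<in> arrays (v ^ t) k S"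
  shows "real (cov (v ^ t) t k S A) \<le> cov_const t v * (real k ^ t / fact t)"
proof -
  let ?H = "separating_sets {..<v ^ t} A {..<k} t"
  have fin: "finite ?H" by (rule finite_subset[of _ "Pow {..<k}"]) (auto simp: separating_sets_def)
  have "{Q. Q \<subseteq> {..<k} \<and> card Q = t \<and> covers (v ^ t) S A Q} \<subseteq> ?H"
    unfolding separating_sets_def
    using covers_imp_separating[OF S(1)] S(2) by (auto dest: finite_subset)
  then have "cov (v ^ t) t k S A \<le> card ?H" unfolding cov_def by (rule card_mono[OF fin])
  then have "real (cov (v ^ t) t k S A) \<le> edge_poly ?H (\<lambda>_. 1)" by (simp add: edge_poly_def)
  also have "\<dots> \<le> cov_const t v / fact t * (sum (\<lambda>_. 1) {..<k}) ^ t"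
    using A by (intro edge_poly_separating_sets_le[OF S v]) (auto simp: arrays_def)
  finally show ?thesis by simp
qed

section \<open>The Frobenius map and finite fields\<close>

lemma (in cring) binomial_formula:
  assumes x: "x \<in> carrier R" and y: "y \<in> carrier R"
  shows "(x \<oplus> y) [^] (n::nat) =
    (\<Oplus>k\<in>{..n}. [(n choose k)] \<cdot> (x [^] k \<otimes> y [^] (n - k)))"
proof (induction n)
  case 0
  then show ?case using x y by simp
next
  case (Suc n)
  define T where "T = (\<lambda>k. [(n choose k)] \<cdot> (x [^] k \<otimes> y [^] (n - k)))"
  define U where "U = (\<lambda>k. [(n choose k)] \<cdot> (x [^] k \<otimes> y [^] (Suc n - k)))"
  define W where "W = (\<lambda>k. [(Suc n choose k)] \<cdot> (x [^] k \<otimes> y [^] (Suc n - k)))"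
  have T: "T \<in> UNIV \<rightarrow> carrier R" and U: "U \<in> UNIV \<rightarrow> carrier R" and W: "W \<in> UNIV \<rightarrow> carrier R"
    using x y by (auto simp: T_def U_def W_def)
  have Tx: "T k \<otimes> x \<oplus> U (Suc k) = W (Suc k)" if "k \<le> n" for k
  proof -
    have "T k \<otimes> x = [(n choose k)] \<cdot> (x [^] Suc k \<otimes> y [^] (n - k))"
      unfolding T_def using x y by (simp add: add_pow_ldistr add_pow_rdistr m_ac)
    moreover have "U (Suc k) = [(n choose Suc k)] \<cdot> (x [^] Suc k \<otimes> y [^] (n - k))"
      unfolding U_def by simp
    ultimately show ?thesis
      unfolding W_def using x y by (simp add: add.nat_pow_mult del: nat_pow_Suc)
  qed
  have Ty: "T k \<otimes> y = U k" if "k \<le> n" for k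
  proof -
    have "T k \<otimes> y = [(n choose k)] \<cdot> (x [^] k \<otimes> (y [^] (n - k) \<otimes> y))"
      unfolding T_def using x y by (simp add: add_pow_ldistr m_assoc)
    also have "y [^] (n - k) \<otimes> y = y [^] (Suc n - k)"
      using that by (simp add: Suc_diff_le)
    finally show ?thesis unfolding U_def .
  qed
  have UU: "(\<Oplus>k\<in>{..n}. U k) = (\<Oplus>k\<in>{..n}. U (Suc k)) \<oplus> U 0"
  proof -
    have "(\<Oplus>k\<in>{..Suc n}. U k) = U (Suc n) \<oplus> (\<Oplus>k\<in>{..n}. U k)"
      by (rule finsum_Suc) (use U in auto)
    moreover have "U (Suc n) = \<zero>" unfolding U_def by (simp add: binomial_eq_0)
    moreover have "(\<Oplus>k\<in>{..Suc n}. U k) = (\<Oplus>k\<in>{..n}. U (Suc k)) \<oplus> U 0"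
      by (rule finsum_Suc2) (use U in auto)
    moreover have "(\<Oplus>k\<in>{..n}. U k) \<in> carrier R" using U by (auto intro: finsum_closed)
    ultimately show ?thesis by simp
  qed
  have "(x \<oplus> y) [^] Suc n = (\<Oplus>k\<in>{..n}. T k) \<otimes> (x \<oplus> y)"
    using Suc by (simp add: T_def)
  also have "\<dots> = (\<Oplus>k\<in>{..n}. T k) \<otimes> x \<oplus> (\<Oplus>k\<in>{..n}. T k) \<otimes> y"
    using x y T by (intro r_distr) (auto intro: finsum_closed)
  also have "(\<Oplus>k\<in>{..n}. T k) \<otimes> x = (\<Oplus>k\<in>{..n}. T k \<otimes> x)"
    using T x by (intro finsum_ldistr) auto
  also have "(\<Oplus>k\<in>{..n}. T k) \<otimes> y = (\<Oplus>k\<in>{..n}. T k \<otimes> y)"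
    using T y by (intro finsum_ldistr) auto
  also have "\<dots> = (\<Oplus>k\<in>{..n}. U k)"
    by (rule finsum_cong') (use U Ty in auto)
  also have "(\<Oplus>k\<in>{..n}. T k \<otimes> x) \<oplus> (\<Oplus>k\<in>{..n}. U k)
      = ((\<Oplus>k\<in>{..n}. T k \<otimes> x) \<oplus> (\<Oplus>k\<in>{..n}. U (Suc k))) \<oplus> U 0"
    unfolding UU using x T U by (intro a_assoc[symmetric]) (auto intro!: finsum_closed)
  also have "(\<Oplus>k\<in>{..n}. T k \<otimes> x) \<oplus> (\<Oplus>k\<in>{..n}. U (Suc k)) = (\<Oplus>k\<in>{..n}. T k \<otimes> x \<oplus> U (Suc k))"
    using x T U by (intro finsum_addf[symmetric]) auto
  also have "\<dots> = (\<Oplus>k\<in>{..n}. W (Suc k))"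
    by (rule finsum_cong') (use W Tx in auto)
  also have "U 0 = W 0" unfolding U_def W_def by simp
  also have "(\<Oplus>k\<in>{..n}. W (Suc k)) \<oplus> W 0 = (\<Oplus>k\<in>{..Suc n}. W k)"
    by (rule finsum_Suc2[symmetric]) (use W in auto)
  finally show ?case unfolding W_def .
qed

text \<open>
  All inner binomial coefficients of row \<open>p\<close> are divisible by \<open>p\<close>.
\<close>
lemma (in cring) frobenius_prime:
  assumes p: "prime (p::nat)" and char: "[p] \<cdot> \<one> = \<zero>"
    and x: "x \<in> carrier R" and y: "y \<in> carrier R"
  shows "(x \<oplus> y) [^] p = x [^] p \<oplus> y [^] p"
proof -
  define W where "W = (\<lambda>k. [(p choose k)] \<cdot> (x [^] k \<otimes> y [^] (p - k)))"
  have W: "W \<in> UNIV \<rightarrow> carrier R" using x y by (auto simp: W_def)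
  have p0: "p > 1" using p prime_gt_1_nat by blast
  have pz: "[p] \<cdot> z = \<zero>" if "z \<in> carrier R" for z
    using add_pow_ldistr[of "\<one>" z p] that char by simp
  have "W k = \<zero>" if "0 < k" "k < p" for k
  proof -
    have "p dvd (p choose k)" using that p by (intro dvd_choose_prime) auto
    then obtain c where c: "p choose k = p * c" by auto
    show ?thesis unfolding W_def c
      using x y by (simp add: pz add.nat_pow_pow[symmetric])
  qed
  then have mid: "(\<Oplus>k\<in>{0<..<p}. W k) = \<zero>"
    by (intro add.finprod_one_eqI) auto
  have "{..p} = insert 0 (insert p {0<..<p})" using p0 by auto
  then have "(\<Oplus>k\<in>{..p}. W k) = (\<Oplus>k\<in>insert 0 (insert p {0<..<p}). W k)" by simp
  also have "\<dots> = W 0 \<oplus> (W p \<oplus> (\<Oplus>k\<in>{0<..<p}. W k))"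
    using p0 W by (subst finsum_insert; (subst finsum_insert)?) auto
  also have "\<dots> = x [^] p \<oplus> y [^] p"
    unfolding mid using x y by (simp add: W_def a_comm)
  finally show ?thesis unfolding binomial_formula[OF x y] W_def .
qed

lemma (in cring) frobenius_prime_power:
  assumes "prime (p::nat)" and "[p] \<cdot> \<one> = \<zero>" and "x \<in> carrier R" and "y \<in> carrier R"
  shows "(x \<oplus> y) [^] (p ^ n) = x [^] (p ^ n) \<oplus> y [^] (p ^ n)"
proof (induction n)
  case 0 then show ?case using assms by simp
next
  case (Suc n)
  have "(x \<oplus> y) [^] (p ^ Suc n) = ((x \<oplus> y) [^] (p ^ n)) [^] p"
    using assms by (simp add: nat_pow_pow mult.commute)
  also have "\<dots> = (x [^] (p ^ n)) [^] p \<oplus> (y [^] (p ^ n)) [^] p"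
    unfolding Suc using assms by (intro frobenius_prime) auto
  finally show ?case using assms by (simp add: nat_pow_pow mult.commute)
qed

lemma (in cring) add_diff_cancel_right':
  assumes "x \<in> carrier R" "y \<in> carrier R" "c \<in> carrier R"
  shows "(x \<oplus> c) \<ominus> (y \<oplus> c) = x \<ominus> y"
  using assms by algebra

lemma (in cring) diff_diff_cancel':
  assumes "x \<in> carrier R" "y \<in> carrier R"
  shows "x \<ominus> (x \<ominus> y) = y"
  using assms by algebra

lemma (in ring_hom_ring) hom_add_pow:
  assumes "x \<in> carrier R"
  shows "h ([(n::nat)] \<cdot>\<^bsub>R\<^esub> x) = [n] \<cdot>\<^bsub>S\<^esub> h x"
  using assms by (induction n) (auto simp: R.add.nat_pow_Suc)

text \<open>
  The fixed points are the roots of \<open>P = X\<^sup>q - X\<close> with \<open>q = p ^ n\<close>, and \<open>P\<close> splits, so it is enough that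
  all roots are simple. If \<open>a\<close> is a root and \<open>A = X - a\<close>, then additivity of the Frobenius map in the
  polynomial ring gives \<open>P = A\<^sup>q - A\<close>. If \<open>A\<^sup>2\<close> divided \<open>P\<close> it would divide \<open>A\<close>, making \<open>A\<close> a unit although
  it vanishes at \<open>a\<close>.
\<close>
lemma (in algebraically_closed) card_frobenius_fixed_points:
  assumes p: "prime (p::nat)" and char: "[p] \<cdot> \<one> = \<zero>" and n: "n > 0"
  shows "card {x \<in> carrier L. x [^] (p ^ n) = x} = p ^ n"
proof -
  define q where "q = p ^ n"
  have q2: "q \<ge> 2"
    using p n prime_ge_2_nat[OF p] self_le_power[of p n] unfolding q_def by linarith
  interpret UP: domain "poly_ring L"
    using univ_poly_is_domain[OF carrier_is_subring] .
  define P where "P = X [^]\<^bsub>poly_ring L\<^esub> q \<ominus>\<^bsub>poly_ring L\<^esub> X"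
  have Xc: "X \<in> carrier (poly_ring L)" using var_closed(1)[OF carrier_is_subring] .
  have Pc: "P \<in> carrier (poly_ring L)" unfolding P_def using Xc by simp
  have evalP: "eval P x = x [^] q \<ominus> x" if x: "x \<in> carrier L" for x
  proof -
    interpret ev: ring_hom_ring "poly_ring L" L "\<lambda>p. eval p x"
      using eval_ring_hom[OF carrier_is_subring x] .
    show ?thesis unfolding P_def using Xc x
      by (simp add: UP.minus_eq minus_eq ev.hom_nat_pow eval_var[OF x])
  qed
  have degP: "degree P = q"
  proof -
    have "X [^]\<^bsub>poly_ring L\<^esub> q = monom \<one> q"
      using unitary_monom_eq_var_pow[OF carrier_is_subring] by simp
    then have d: "degree (X [^]\<^bsub>poly_ring L\<^esub> q) = q" by (simp add: monom_def)
    have d': "degree (\<ominus>\<^bsub>poly_ring L\<^esub> X) = 1"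
      using univ_poly_a_inv_degree[OF carrier_is_subring Xc] by (simp add: var_def)
    have pc: "polynomial (carrier L) (X [^]\<^bsub>poly_ring L\<^esub> q)" "polynomial (carrier L) (\<ominus>\<^bsub>poly_ring L\<^esub> X)"
      using Xc by (auto simp: univ_poly_carrier)
    have "degree P = max (degree (X [^]\<^bsub>poly_ring L\<^esub> q)) (degree (\<ominus>\<^bsub>poly_ring L\<^esub> X))"
      unfolding P_def UP.minus_eq univ_poly_add
      by (rule poly_add_degree_eq[OF carrier_is_subring pc]) (use d d' q2 in auto)
    then show ?thesis using d d' q2 by simp
  qed
  have Pne: "P \<noteq> []" using degP q2 by auto
  have roots: "set_mset (roots P) = {x \<in> carrier L. x [^] q = x}"
    using roots_mem_iff_is_root[OF Pc] Pne evalP by (auto simp: is_root_def)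
  interpret C: ring_hom_ring L "poly_ring L" poly_of_const
    using canonical_embedding_ring_hom[OF carrier_is_subring] by simp
  have charP: "[p] \<cdot>\<^bsub>poly_ring L\<^esub> \<one>\<^bsub>poly_ring L\<^esub> = \<zero>\<^bsub>poly_ring L\<^esub>"
    using C.hom_add_pow[OF one_closed, of p] char by simp
  have simple: "count (roots P) a \<le> 1" for a
  proof (rule ccontr)
    assume "\<not> count (roots P) a \<le> 1"
    then have am: "2 \<le> alg_mult P a" and "a \<in># roots P"
      using alg_mult_eq_count_roots[OF Pc] by (simp_all flip: count_greater_zero_iff)
    then have a: "a \<in> carrier L" and aq: "a [^] q = a"
      using roots by auto
    define A where "A = [\<one>, \<ominus> a]"
    define c where "c = poly_of_const a"
    have Ac: "A \<in> carrier (poly_ring L)"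
      using a unfolding A_def sym[OF univ_poly_carrier] polynomial_def by auto
    have cc: "c \<in> carrier (poly_ring L)" unfolding c_def using a by simp
    have cq: "c [^]\<^bsub>poly_ring L\<^esub> q = c"
      unfolding c_def C.hom_nat_pow[OF a, of q, symmetric] aq ..
    have XA: "X = A \<oplus>\<^bsub>poly_ring L\<^esub> c"
      using a unfolding c_def A_def univ_poly_add by (auto simp: poly_of_const_def var_def l_neg)
    have "P = (A \<oplus>\<^bsub>poly_ring L\<^esub> c) [^]\<^bsub>poly_ring L\<^esub> q \<ominus>\<^bsub>poly_ring L\<^esub> (A \<oplus>\<^bsub>poly_ring L\<^esub> c)"
      unfolding P_def XA ..
    also have "(A \<oplus>\<^bsub>poly_ring L\<^esub> c) [^]\<^bsub>poly_ring L\<^esub> q = A [^]\<^bsub>poly_ring L\<^esub> q \<oplus>\<^bsub>poly_ring L\<^esub> c"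
      unfolding q_def by (subst UP.frobenius_prime_power[OF p charP Ac cc]) (use cq q_def in simp)
    finally have "P = (A [^]\<^bsub>poly_ring L\<^esub> q \<oplus>\<^bsub>poly_ring L\<^esub> c) \<ominus>\<^bsub>poly_ring L\<^esub> (A \<oplus>\<^bsub>poly_ring L\<^esub> c)" .
    moreover have Aqc: "A [^]\<^bsub>poly_ring L\<^esub> q \<in> carrier (poly_ring L)" using Ac by simp
    ultimately have P_eq: "P = A [^]\<^bsub>poly_ring L\<^esub> q \<ominus>\<^bsub>poly_ring L\<^esub> A"
      using UP.add_diff_cancel_right'[OF Aqc Ac cc] by simp
    have A_eq: "A = A [^]\<^bsub>poly_ring L\<^esub> q \<ominus>\<^bsub>poly_ring L\<^esub> P"
      unfolding P_eq using UP.diff_diff_cancel'[OF Aqc Ac] by simp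
    have "(A [^]\<^bsub>poly_ring L\<^esub> (2::nat)) pdivides P"
      using le_alg_mult_imp_pdivides[OF a Pc am] unfolding A_def .
    then obtain Q where Q: "Q \<in> carrier (poly_ring L)" "P = A [^]\<^bsub>poly_ring L\<^esub> (2::nat) \<otimes>\<^bsub>poly_ring L\<^esub> Q"
      unfolding pdivides_def factor_def by auto
    define B where "B = A [^]\<^bsub>poly_ring L\<^esub> (q - 2) \<ominus>\<^bsub>poly_ring L\<^esub> Q"
    have Bc: "B \<in> carrier (poly_ring L)" unfolding B_def using Ac Q(1) by simp
    have "A [^]\<^bsub>poly_ring L\<^esub> q = A [^]\<^bsub>poly_ring L\<^esub> (2::nat) \<otimes>\<^bsub>poly_ring L\<^esub> A [^]\<^bsub>poly_ring L\<^esub> (q - 2)"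
      by (simp only: UP.nat_pow_mult[OF Ac] le_add_diff_inverse[OF q2])
    then have "A [^]\<^bsub>poly_ring L\<^esub> q \<ominus>\<^bsub>poly_ring L\<^esub> P = A [^]\<^bsub>poly_ring L\<^esub> (2::nat) \<otimes>\<^bsub>poly_ring L\<^esub> B"
      unfolding B_def Q(2) using Ac Q(1) by (simp add: UP.minus_eq UP.r_distr UP.r_minus)
    with A_eq have "A = A [^]\<^bsub>poly_ring L\<^esub> (2::nat) \<otimes>\<^bsub>poly_ring L\<^esub> B" by (rule trans)
    also have "\<dots> = A \<otimes>\<^bsub>poly_ring L\<^esub> (A \<otimes>\<^bsub>poly_ring L\<^esub> B)"
      using Ac Bc by (simp add: numeral_2_eq_2 UP.m_assoc)
    finally have "A \<otimes>\<^bsub>poly_ring L\<^esub> \<one>\<^bsub>poly_ring L\<^esub> = A \<otimes>\<^bsub>poly_ring L\<^esub> (A \<otimes>\<^bsub>poly_ring L\<^esub> B)"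
      unfolding UP.r_one[OF Ac] .
    moreover have "A \<noteq> \<zero>\<^bsub>poly_ring L\<^esub>" unfolding A_def univ_poly_zero by simp
    ultimately have one: "\<one>\<^bsub>poly_ring L\<^esub> = A \<otimes>\<^bsub>poly_ring L\<^esub> B"
      using UP.m_lcancel[OF _ Ac UP.one_closed, of "A \<otimes>\<^bsub>poly_ring L\<^esub> B"] Ac Bc by simp
    interpret ev: ring_hom_ring "poly_ring L" L "\<lambda>p. eval p a"
      using eval_ring_hom[OF carrier_is_subring a] .
    have "eval A a = \<zero>" unfolding A_def using a by (simp add: r_neg)
    then have "\<one> = \<zero>"
      using arg_cong[OF one, of "\<lambda>p. eval p a"] Ac Bc by simp
    then show False using one_not_zero by simp
  qed
  have "size (roots P) = q"
    using roots_over_carrier[OF Pc] degP unfolding splitted_def by simp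
  moreover have "roots P = mset_set (set_mset (roots P))"
  proof (rule multiset_eqI)
    fix a show "count (roots P) a = count (mset_set (set_mset (roots P))) a"
      using simple[of a] by (cases "a \<in># roots P") (auto simp: count_mset_set not_in_iff intro: le_antisym)
  qed
  then have "size (roots P) = card (set_mset (roots P))"
    by (metis size_mset_set)
  ultimately show ?thesis
    using roots unfolding q_def by simp
qed

text \<open>
  In an algebraic closure of the prime field, the elements fixed by the \<open>n\<close>-th power of the Frobenius map form a
  subfield with \<open>p ^ n\<close> elements, contained in the one for every multiple of \<open>n\<close>.
\<close>
theorem finite_field_tower:
  assumes p: "prime (p::nat)" and n: "n > 0" and m: "m > 0"
  obtains L :: "(((int list \<times> nat) multiset) \<Rightarrow> int) ring" and K E where
    "field L" "subfield K L" "subfield E L" "K \<subseteq> E" "card K = p ^ n" "card E = p ^ (n * m)"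
proof -
  interpret F: residues_prime p "residue_ring (int p)"
    using p by unfold_locales (auto)
  interpret F: field "residue_ring (int p)" by (rule F.is_field)
  define L where "L = F.alg_closure"
  have "algebraic_closure L (F.indexed_const ` carrier (residue_ring (int p)))"
    and hom: "F.indexed_const \<in> ring_hom (residue_ring (int p)) L"
    using F.alg_closureE unfolding L_def by auto
  then interpret L: algebraic_closure L "F.indexed_const ` carrier (residue_ring (int p))"
    by simp
  interpret h: ring_hom_ring "residue_ring (int p)" L "F.indexed_const"
    using hom by (intro ring_hom_ringI2) (auto intro: F.ring_axioms L.ring_axioms)
  have "[p] \<cdot>\<^bsub>residue_ring (int p)\<^esub> \<one>\<^bsub>residue_ring (int p)\<^esub> = \<zero>\<^bsub>residue_ring (int p)\<^esub>"
  proof -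
    have "Coset.order (add_monoid (residue_ring (int p))) = p"
      by (simp add: Coset.order_def residue_ring_def)
    then show ?thesis using F.add.pow_order_eq_1[OF F.one_closed] by simp
  qed
  then have char: "[p] \<cdot>\<^bsub>L\<^esub> \<one>\<^bsub>L\<^esub> = \<zero>\<^bsub>L\<^esub>"
    using h.hom_add_pow[OF F.one_closed, of p] by simp
  define G where "G = (\<lambda>j. {x \<in> carrier L. x [^]\<^bsub>L\<^esub> (p ^ j) = x})"
  have p0: "p > 0" using p prime_gt_0_nat by blast
  have sub: "subfield (G j) L" for j
  proof (rule L.subfieldI')
    have add: "x \<oplus>\<^bsub>L\<^esub> y \<in> G j" if "x \<in> G j" "y \<in> G j" for x y
      using that L.frobenius_prime_power[OF p char] unfolding G_def by auto
    show "subring (G j) L"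
    proof (rule L.subringI)
      show "\<ominus>\<^bsub>L\<^esub> x \<in> G j" if x: "x \<in> G j" for x
      proof -
        have xc: "x \<in> carrier L" using x unfolding G_def by simp
        have "(x \<oplus>\<^bsub>L\<^esub> \<ominus>\<^bsub>L\<^esub> x) [^]\<^bsub>L\<^esub> (p ^ j) = x \<oplus>\<^bsub>L\<^esub> (\<ominus>\<^bsub>L\<^esub> x) [^]\<^bsub>L\<^esub> (p ^ j)"
          using L.frobenius_prime_power[OF p char xc, of "\<ominus>\<^bsub>L\<^esub> x" j] x xc unfolding G_def by simp
        then have "x \<oplus>\<^bsub>L\<^esub> (\<ominus>\<^bsub>L\<^esub> x) [^]\<^bsub>L\<^esub> (p ^ j) = \<zero>\<^bsub>L\<^esub>"
          using xc p0 by (simp add: L.r_neg L.nat_pow_zero)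
        then have "(\<ominus>\<^bsub>L\<^esub> x) [^]\<^bsub>L\<^esub> (p ^ j) = \<ominus>\<^bsub>L\<^esub> x"
          using xc L.sum_zero_eq_neg[of "(\<ominus>\<^bsub>L\<^esub> x) [^]\<^bsub>L\<^esub> (p ^ j)" x] by (simp add: L.a_comm)
        then show ?thesis using xc unfolding G_def by simp
      qed
    qed (use add in \<open>auto simp: G_def L.nat_pow_distrib\<close>)
    show "inv\<^bsub>L\<^esub> x \<in> G j" if "x \<in> G j - {\<zero>\<^bsub>L\<^esub>}" for x
    proof -
      have x: "x \<in> Units L" "x [^]\<^bsub>L\<^esub> (p ^ j) = x" using that L.field_Units unfolding G_def by auto
      then have xc: "x \<in> carrier L" "inv\<^bsub>L\<^esub> x \<in> carrier L" by auto
      have "(inv\<^bsub>L\<^esub> x) [^]\<^bsub>L\<^esub> (p ^ j) \<otimes>\<^bsub>L\<^esub> x = (inv\<^bsub>L\<^esub> x \<otimes>\<^bsub>L\<^esub> x) [^]\<^bsub>L\<^esub> (p ^ j)"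
        using xc x(2) by (simp add: L.nat_pow_distrib)
      then have "(inv\<^bsub>L\<^esub> x) [^]\<^bsub>L\<^esub> (p ^ j) \<otimes>\<^bsub>L\<^esub> x = \<one>\<^bsub>L\<^esub>"
        using x(1) by simp
      then have "inv\<^bsub>L\<^esub> x = (inv\<^bsub>L\<^esub> x) [^]\<^bsub>L\<^esub> (p ^ j)"
        using xc by (intro L.comm_inv_char) (auto simp: L.m_comm)
      then show ?thesis using xc unfolding G_def by simp
    qed
  qed
  have GG: "G n \<subseteq> G (n * m)"
  proof
    fix x assume x: "x \<in> G n"
    have "x [^]\<^bsub>L\<^esub> (p ^ (n * j)) = x" for j
    proof (induction j)
      case (Suc j)
      have "x [^]\<^bsub>L\<^esub> (p ^ (n * Suc j)) = (x [^]\<^bsub>L\<^esub> (p ^ (n * j))) [^]\<^bsub>L\<^esub> (p ^ n)"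
        using x unfolding G_def by (simp add: L.nat_pow_pow power_add mult.commute)
      then show ?case using Suc x unfolding G_def by simp
    qed (use x in \<open>auto simp: G_def\<close>)
    then show "x \<in> G (n * m)" using x unfolding G_def by auto
  qed
  show thesis
  proof (rule that)
    show "field L" by (rule L.field_axioms)
    show "card (G n) = p ^ n" "card (G (n * m)) = p ^ (n * m)"
      using L.card_frobenius_fixed_points[OF p char] n m unfolding G_def by auto
  qed (use sub GG in auto)
qed

section \<open>Linear functionals over a finite subfield\<close>

context ring
begin

lemma card_Span:
  assumes K: "subfield K R" "finite K" and Us: "independent K Us"
  shows "finite (Span K Us)" "card (Span K Us) = card K ^ length Us"
proof -
  let ?C = "{Ks. set Ks \<subseteq> K \<and> length Ks = length Us}"
  have img: "Span K Us = (\<lambda>Ks. combine Ks Us) ` ?C"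
    unfolding Span_eq_combine_set_length_version[OF K(1) independent_in_carrier[OF Us]] by auto
  have inj: "inj_on (\<lambda>Ks. combine Ks Us) ?C"
    using unique_decomposition[OF K(1) Us] img by (intro inj_onI) blast
  show "finite (Span K Us)" unfolding img using finite_lists_length_eq[OF K(2)] by simp
  show "card (Span K Us) = card K ^ length Us"
    unfolding img card_image[OF inj] using card_lists_length_eq[OF K(2)] by simp
qed

lemma combine_in_subfield:
  assumes "subfield E R" and "set Ks \<subseteq> E" and "set Us \<subseteq> E"
  shows "combine Ks Us \<in> E"
  using assms(2,3) subringE(2,6,7)[OF subfieldE(1)[OF assms(1)]]
  by (induction Ks Us rule: combine.induct) auto

lemma Span_in_subfield:
  assumes "subfield K R" "subfield E R" "K \<subseteq> E" "set Us \<subseteq> E"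
  shows "Span K Us \<subseteq> E"
  using Span_eq_combine_set[OF assms(1), of Us] combine_in_subfield[OF assms(2) _ assms(4)]
    assms(3,4) subfieldE(3)[OF assms(2)] by auto

text \<open>
  A new head of an independent list may be anything outside the span of the tail.
\<close>
lemma card_independent_lists:
  assumes K: "subfield K R" "finite K" and E: "subfield E R" "finite E" and KE: "K \<subseteq> E"
  shows "card {Us. set Us \<subseteq> E \<and> length Us = n \<and> independent K Us} = (\<Prod>i<n. card E - card K ^ i)"
proof (induction n)
  case 0
  have "{Us. set Us \<subseteq> E \<and> length Us = 0 \<and> independent K Us} = {[]}" by auto
  then show ?case by simp
next
  case (Suc n)
  let ?B = "\<lambda>n. {Us. set Us \<subseteq> E \<and> length Us = n \<and> independent K Us}"
  have fin: "finite (?B m)" for m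
    by (rule finite_subset[OF _ finite_lists_length_eq[OF E(2), of m]]) auto
  have "?B (Suc n) = (\<lambda>(Us, u). u # Us) ` (SIGMA Us:?B n. E - Span K Us)"
  proof (intro equalityI subsetI)
    fix Vs assume "Vs \<in> ?B (Suc n)"
    then obtain u Us where "Vs = u # Us" "Us \<in> ?B n" "u \<in> E - Span K Us"
      by (auto simp: length_Suc_conv elim: independent.cases)
    then show "Vs \<in> (\<lambda>(Us, u). u # Us) ` (SIGMA Us:?B n. E - Span K Us)" by force
  qed (use subfieldE(3)[OF E(1)] in \<open>auto intro!: li_Cons\<close>)
  then have "card (?B (Suc n)) = card (SIGMA Us:?B n. E - Span K Us)"
    by (simp only:) (intro card_image, auto simp: inj_on_def)
  also have "\<dots> = (\<Sum>Us\<in>?B n. card (E - Span K Us))"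
    using fin E(2) by (intro card_SigmaI) auto
  also have "\<dots> = (\<Sum>Us\<in>?B n. card E - card K ^ n)"
  proof (rule sum.cong[OF refl])
    fix Us assume "Us \<in> ?B n"
    then have Us: "set Us \<subseteq> E" "length Us = n" "independent K Us" by auto
    show "card (E - Span K Us) = card E - card K ^ n"
      using card_Diff_subset[OF card_Span(1)[OF K Us(3)] Span_in_subfield[OF K(1) E(1) KE Us(1)]]
        card_Span(2)[OF K Us(3)] Us(2) by simp
  qed
  also have "\<dots> = (\<Prod>i<Suc n. card E - card K ^ i)"
    using Suc by simp
  finally show ?case .
qed

lemma Span_eq_subfield:
  assumes K: "subfield K R" "finite K" and E: "subfield E R" "finite E" and KE: "K \<subseteq> E"
    and t: "card E = card K ^ t"
    and Us: "independent K Us" "set Us \<subseteq> E" "length Us = t"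
  shows "Span K Us = E"
  using card_subset_eq[OF E(2) Span_in_subfield[OF K(1) E(1) KE Us(2)]] card_Span(2)[OF K Us(1)] t Us(3)
  by simp

text \<open>
  A basis exists because the number of independent lists of length \<open>t\<close> is positive; the functional is
  the first coordinate with respect to it.
\<close>
lemma exists_linear_functional:
  assumes K: "subfield K R" "finite K" and E: "subfield E R" "finite E" and KE: "K \<subseteq> E"
    and t: "card E = card K ^ t" "t > 0"
  obtains lam where "\<And>x. x \<in> E \<Longrightarrow> lam x \<in> K"
    and "\<And>x y. x \<in> E \<Longrightarrow> y \<in> E \<Longrightarrow> lam (x \<oplus> y) = lam x \<oplus> lam y"
    and "\<And>k x. k \<in> K \<Longrightarrow> x \<in> E \<Longrightarrow> lam (k \<otimes> x) = k \<otimes> lam x"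
    and "\<exists>x\<in>E. lam x \<noteq> \<zero>"
proof -
  have K01: "{\<zero>, \<one>} \<subseteq> K" "\<zero> \<noteq> \<one>"
    using subringE(2,3)[OF subfieldE(1)[OF K(1)]] subfieldE(6)[OF K(1)] by auto
  then have "card {\<zero>, \<one>} \<le> card K" by (intro card_mono[OF K(2)])
  then have q2: "card K \<ge> 2" using K01(2) by simp
  have "(\<Prod>i<t. card E - card K ^ i) > 0"
    unfolding t(1) using q2 by (intro prod_pos) (auto intro: power_strict_increasing)
  then have "{Us. set Us \<subseteq> E \<and> length Us = t \<and> independent K Us} \<noteq> {}"
    using card_independent_lists[OF K E KE, of t] by (metis card.empty less_irrefl)
  then obtain Bs where Bs: "set Bs \<subseteq> E" "length Bs = t" "independent K Bs" by auto
  have Bc: "set Bs \<subseteq> carrier R" and Kc: "K \<subseteq> carrier R"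
    using Bs(1) subfieldE(3)[OF E(1)] subfieldE(3)[OF K(1)] by auto
  have Sp: "Span K Bs = E" by (rule Span_eq_subfield[OF K E KE t(1) Bs(3,1,2)])
  have "\<forall>x\<in>E. \<exists>Ks. set Ks \<subseteq> K \<and> length Ks = t \<and> x = combine Ks Bs"
    using Span_mem_iff_length_version[OF K(1) Bc] unfolding Sp Bs(2) by simp
  then obtain c where c: "\<And>x. x \<in> E \<Longrightarrow> set (c x) \<subseteq> K" "\<And>x. x \<in> E \<Longrightarrow> length (c x) = t"
      "\<And>x. x \<in> E \<Longrightarrow> x = combine (c x) Bs" by metis
  have cu: "c x = Ks" if "set Ks \<subseteq> K" "length Ks = t" "x = combine Ks Bs" for x Ks
  proof -
    have xE: "x \<in> E" using that combine_in_subfield[OF E(1) _ Bs(1)] KE by auto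
    then have "\<exists>!Ks. set Ks \<subseteq> K \<and> length Ks = t \<and> x = combine Ks Bs"
      using unique_decomposition[OF K(1) Bs(3), of x] unfolding Sp Bs(2) by blast
    then show ?thesis using c[OF xE] that by blast
  qed
  have ne: "c x \<noteq> []" if "x \<in> E" for x using c(2)[OF that] t(2) by auto
  note Kr = subringE[OF subfieldE(1)[OF K(1)]]
  show thesis
  proof (rule that[of "\<lambda>x. hd (c x)"])
    show "hd (c x) \<in> K" if "x \<in> E" for x using c(1)[OF that] hd_in_set[OF ne[OF that]] by auto
    show "hd (c (x \<oplus> y)) = hd (c x) \<oplus> hd (c y)" if x: "x \<in> E" and y: "y \<in> E" for x y
    proof -
      have "c (x \<oplus> y) = map2 (\<oplus>) (c x) (c y)"
      proof (rule cu)
        show "set (map2 (\<oplus>) (c x) (c y)) \<subseteq> K"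
        proof
          fix z assume "z \<in> set (map2 (\<oplus>) (c x) (c y))"
          then obtain a b where ab: "(a, b) \<in> set (zip (c x) (c y))" "z = a \<oplus> b" by auto
          then have "a \<in> K" "b \<in> K"
            using c(1)[OF x] c(1)[OF y] set_zip_leftD[OF ab(1)] set_zip_rightD[OF ab(1)] by blast+
          then show "z \<in> K" unfolding ab(2) by (rule Kr(7))
        qed
        show "length (map2 (\<oplus>) (c x) (c y)) = t" using c(2) x y by simp
        show "x \<oplus> y = combine (map2 (\<oplus>) (c x) (c y)) Bs"
          using combine_add[of "c x" Bs "c y", unfolded Bs(2), OF c(2)[OF x] c(2)[OF y]
              subset_trans[OF c(1)[OF x] Kc] subset_trans[OF c(1)[OF y] Kc] Bc]
          unfolding c(3)[OF x, symmetric] c(3)[OF y, symmetric] .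
      qed
      then show ?thesis using ne[OF x] ne[OF y] by (simp add: hd_map hd_zip)
    qed
    show "hd (c (k \<otimes> x)) = k \<otimes> hd (c x)" if k: "k \<in> K" and x: "x \<in> E" for k x
    proof -
      have "c (k \<otimes> x) = map ((\<otimes>) k) (c x)"
      proof (rule cu)
        show "set (map ((\<otimes>) k) (c x)) \<subseteq> K" using c(1)[OF x] k Kr(6) by auto
        show "length (map ((\<otimes>) k) (c x)) = t" using c(2)[OF x] by simp
        show "k \<otimes> x = combine (map ((\<otimes>) k) (c x)) Bs"
          using combine_r_distr[OF subset_trans[OF c(1)[OF x] Kc] Bc, of k] k Kc
          unfolding c(3)[OF x, symmetric] by blast
      qed
      then show ?thesis using ne[OF x] by (simp add: hd_map)
    qed
    define Ks where "Ks = \<one> # replicate (t - 1) \<zero>"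
    have Ks: "set Ks \<subseteq> K" "length Ks = t" unfolding Ks_def using K01 t(2) by auto
    have "combine Ks Bs \<in> E" using Ks(1) combine_in_subfield[OF E(1) _ Bs(1)] KE by auto
    moreover have "hd (c (combine Ks Bs)) = \<one>" using cu[OF Ks refl] unfolding Ks_def by simp
    ultimately show "\<exists>x\<in>E. hd (c x) \<noteq> \<zero>" using K01(2) by force
  qed
qed

lemma functional_vanishes_on_combine:
  assumes E: "subfield E R" and KE: "K \<subseteq> E" and d: "d \<in> E"
    and add: "\<And>x y. x \<in> E \<Longrightarrow> y \<in> E \<Longrightarrow> lam (x \<oplus> y) = lam x \<oplus> lam y"
    and scale: "\<And>k x. k \<in> K \<Longrightarrow> x \<in> E \<Longrightarrow> lam (k \<otimes> x) = k \<otimes> lam x"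
    and z: "lam \<zero> = \<zero>"
  shows "set Ks \<subseteq> K \<Longrightarrow> set Us \<subseteq> E \<Longrightarrow> (\<And>u. u \<in> set Us \<Longrightarrow> lam (d \<otimes> u) = \<zero>)
    \<Longrightarrow> lam (d \<otimes> combine Ks Us) = \<zero>"
proof (induction Ks Us rule: combine.induct)
  case (1 k Ks u Us)
  note Er = subringE[OF subfieldE(1)[OF E]]
  have k: "k \<in> K" "k \<in> E" and u: "u \<in> E" using 1 KE by auto
  have cc: "combine Ks Us \<in> E" using combine_in_subfield[OF E, of Ks Us] 1 KE by auto
  note c = k(2)[THEN subsetD[OF Er(1)]] u[THEN subsetD[OF Er(1)]] cc[THEN subsetD[OF Er(1)]] d[THEN subsetD[OF Er(1)]]
  have comm: "d \<otimes> k = k \<otimes> d" using subfieldE(4)[OF E d k(2)] .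
  have "d \<otimes> combine (k # Ks) (u # Us) = k \<otimes> (d \<otimes> u) \<oplus> d \<otimes> combine Ks Us"
    using c comm by (simp add: r_distr flip: m_assoc)
  then have "lam (d \<otimes> combine (k # Ks) (u # Us)) = k \<otimes> lam (d \<otimes> u) \<oplus> lam (d \<otimes> combine Ks Us)"
    using add scale k u cc d Er(6) by simp
  then show ?case using 1 c by simp
qed (use z subfieldE(3)[OF E] d in auto)

text \<open>
  If \<open>r\<close> and \<open>r'\<close> give the same entries, then \<open>lam\<close> vanishes on \<open>d * u\<close> for \<open>d = r - r'\<close> and every \<open>u\<close> in
  the basis, hence on \<open>d * E\<close>. If \<open>d\<close> were nonzero this would be all of \<open>E\<close>. So distinct rows differ, and
  there are as many rows as patterns.
\<close>
lemma bij_betw_functional_array: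
  assumes K: "subfield K R" "finite K" and E: "subfield E R" "finite E" and KE: "K \<subseteq> E"
    and t: "card E = card K ^ t"
    and lam: "\<And>x. x \<in> E \<Longrightarrow> lam x \<in> K"
    and add: "\<And>x y. x \<in> E \<Longrightarrow> y \<in> E \<Longrightarrow> lam (x \<oplus> y) = lam x \<oplus> lam y"
    and scale: "\<And>k x. k \<in> K \<Longrightarrow> x \<in> E \<Longrightarrow> lam (k \<otimes> x) = k \<otimes> lam x"
    and ne: "\<exists>x\<in>E. lam x \<noteq> \<zero>"
    and Us: "independent K Us" "set Us \<subseteq> E" "length Us = t"
  shows "bij_betw (\<lambda>r. map (\<lambda>u. lam (r \<otimes> u)) Us) E {Ks. set Ks \<subseteq> K \<and> length Ks = t}"
proof -
  note Er = subringE[OF subfieldE(1)[OF E(1)]]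
  note Kr = subringE[OF subfieldE(1)[OF K(1)]]
  have Ec: "x \<in> carrier R" if "x \<in> E" for x using that Er(1) by auto
  have Kc: "x \<in> carrier R" if "x \<in> K" for x using that Kr(1) by auto
  have z: "lam \<zero> = \<zero>"
    using scale[OF Kr(2) Er(2)] lam[OF Er(2)] Kc by simp
  let ?f = "\<lambda>r. map (\<lambda>u. lam (r \<otimes> u)) Us"
  have inj: "inj_on ?f E"
  proof (rule inj_onI)
    fix r r' assume r: "r \<in> E" and r': "r' \<in> E" and eq: "?f r = ?f r'"
    define d where "d = r \<ominus> r'"
    have d: "d \<in> E" unfolding d_def minus_eq using r r' Er(5,7) by simp
    have van: "lam (d \<otimes> u) = \<zero>" if u: "u \<in> set Us" for u
    proof -
      have uE: "u \<in> E" using u Us(2) by auto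
      have "r \<otimes> u = d \<otimes> u \<oplus> r' \<otimes> u"
        unfolding d_def using Ec[OF r] Ec[OF r'] Ec[OF uE] by (simp add: minus_eq l_distr l_minus a_assoc l_neg)
      then have "lam (r \<otimes> u) = lam (d \<otimes> u) \<oplus> lam (r' \<otimes> u)"
        using add d r' uE Er(6) by simp
      moreover have "lam (r \<otimes> u) = lam (r' \<otimes> u)" using eq u by auto
      ultimately show ?thesis
        using add.r_cancel_one[OF Kc[OF lam[OF Er(6)[OF r' uE]]] Kc[OF lam[OF Er(6)[OF d uE]]]] by simp
    qed
    show "r = r'"
    proof (rule ccontr)
      assume "r \<noteq> r'"
      then have d0: "d \<in> E - {\<zero>}" using r_right_minus_eq[OF Ec[OF r] Ec[OF r']] d unfolding d_def by simp
      obtain x where x: "x \<in> E" "lam x \<noteq> \<zero>" using ne by auto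
      have inv: "inv d \<in> E" "d \<otimes> inv d = \<one>" using subfield_m_inv[OF E(1) d0] by auto
      have "inv d \<otimes> x \<in> Span K Us"
        using Span_eq_subfield[OF K E KE t Us] inv x Er(6) by simp
      then obtain Ks where Ks: "set Ks \<subseteq> K" "inv d \<otimes> x = combine Ks Us"
        using Span_mem_iff_length_version[OF K(1), of Us] Us(2) Er(1) by auto
      have "lam (d \<otimes> (inv d \<otimes> x)) = \<zero>"
        unfolding Ks(2) by (rule functional_vanishes_on_combine[OF E(1) KE d add scale z Ks(1) Us(2) van])
      moreover have "d \<otimes> (inv d \<otimes> x) = x" using inv Ec d x by (simp flip: m_assoc)
      ultimately show False using x by simp
    qed
  qed
  have sub: "?f ` E \<subseteq> {Ks. set Ks \<subseteq> K \<and> length Ks = t}"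
    using lam Er(6) Us(2,3) by (auto simp: subset_iff)
  have "card (?f ` E) = card {Ks. set Ks \<subseteq> K \<and> length Ks = t}"
    using card_image[OF inj] t card_lists_length_eq[OF K(2)] by simp
  then have "?f ` E = {Ks. set Ks \<subseteq> K \<and> length Ks = t}"
    using card_subset_eq[OF finite_lists_length_eq[OF K(2)] sub] by simp
  with inj show ?thesis unfolding bij_betw_def by simp
qed

end

section \<open>Arrays of linear functionals\<close>

context ring
begin

lemma line_extension_scale:
  assumes K: "subfield K R" and k: "k \<in> K - {\<zero>}" and u: "u \<in> carrier R"
  shows "line_extension K (k \<otimes> u) V = line_extension K u V"
proof -
  note Kr = subringE[OF subfieldE(1)[OF K]]
  have kc: "k \<in> carrier R" using k Kr(1) by auto
  have i: "inv k \<in> K" "inv k \<otimes> k = \<one>" using subfield_m_inv[OF K k] by auto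
  have ic: "inv k \<in> carrier R" using i Kr(1) by auto
  show ?thesis
  proof (intro equalityI subsetI)
    fix x assume "x \<in> line_extension K (k \<otimes> u) V"
    then obtain a v where a: "a \<in> K" "v \<in> V" "x = a \<otimes> (k \<otimes> u) \<oplus> v"
      unfolding line_extension_mem_iff by auto
    have "a \<in> carrier R" using a Kr(1) by auto
    then have "x = (a \<otimes> k) \<otimes> u \<oplus> v" using a(3) kc u by (simp add: m_assoc)
    moreover have "a \<otimes> k \<in> K" using a(1) k Kr(6) by auto
    ultimately show "x \<in> line_extension K u V" unfolding line_extension_mem_iff using a(2) by blast
  next
    fix x assume "x \<in> line_extension K u V"
    then obtain a v where a: "a \<in> K" "v \<in> V" "x = a \<otimes> u \<oplus> v"
      unfolding line_extension_mem_iff by auto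
    have ac: "a \<in> carrier R" using a Kr(1) by auto
    have "inv k \<otimes> (k \<otimes> u) = u" using i ic kc u by (simp flip: m_assoc)
    then have "(a \<otimes> inv k) \<otimes> (k \<otimes> u) = a \<otimes> u" using ac ic kc u by (simp add: m_assoc)
    then have "x = (a \<otimes> inv k) \<otimes> (k \<otimes> u) \<oplus> v" using a(3) by simp
    moreover have "a \<otimes> inv k \<in> K" using a(1) i Kr(6) by auto
    ultimately show "x \<in> line_extension K (k \<otimes> u) V" unfolding line_extension_mem_iff using a(2) by blast
  qed
qed

text \<open>
  Independence depends only on the lines spanned by the vectors, so columns may be replaced by
  representatives of their lines.
\<close>
lemma independent_scale:
  assumes K: "subfield K R"
  shows "list_all2 (\<lambda>u v. \<exists>k\<in>K - {\<zero>}. v = k \<otimes> u) Us Vs \<Longrightarrow> independent K Us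
    \<Longrightarrow> independent K Vs \<and> Span K Vs = Span K Us"
proof (induction Us Vs rule: list_all2_induct)
  case (Cons u Us v Vs)
  then obtain k where k: "k \<in> K - {\<zero>}" and v: "v = k \<otimes> u" by auto
  have u: "u \<in> carrier R" "u \<notin> Span K Us" "independent K Us"
    using Cons.prems by (auto elim: independent.cases)
  have IH: "independent K Vs" "Span K Vs = Span K Us" using Cons.IH u(3) by auto
  have "v \<notin> Span K Vs"
    unfolding IH(2) v using Span_m_inv_simprule[OF K independent_in_carrier[OF u(3)] k u(1)] u(2) by blast
  moreover have "v \<in> carrier R" unfolding v using u(1) k subfieldE(3)[OF K] by auto
  ultimately have "independent K (v # Vs)" using IH(1) by (intro li_Cons)
  moreover have "Span K (v # Vs) = Span K (u # Us)"
    using line_extension_scale[OF K k u(1)] IH(2) unfolding v by simp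
  ultimately show ?case ..
qed auto

lemma zero_notin_independent:
  assumes K: "subfield K R" shows "independent K Us \<Longrightarrow> \<zero> \<notin> set Us"
proof (induction Us)
  case (Cons u Us)
  then have "independent K Us" "u \<notin> Span K Us" by (auto elim: independent.cases)
  moreover have "\<zero> \<in> Span K Us"
    using Span_subgroup_props(2)[OF K independent_in_carrier] \<open>independent K Us\<close> by simp
  ultimately show ?case using Cons.IH by auto
qed simp

end

text \<open>
  What the counting arguments need to know about the array with rows \<open>R = E\<close>, columns
  \<open>Z = E - {0}\<close> and symbols \<open>K\<close>: \<open>I\<close> collects the \<open>K\<close>-bases of \<open>E\<close> as lists, and \<open>rep\<close> picks one vector on each
  line through the origin.
\<close>
locale linear_columns =
  fixes q t :: nat and R :: "'r set" and K :: "'s set" and ent :: "'r \<Rightarrow> 'c \<Rightarrow> 's"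
    and Z :: "'c set" and I :: "'c list set" and rep :: "'c \<Rightarrow> 'c"
  assumes q: "q \<ge> 2"
    and card_R: "card R = q ^ t" and card_K: "card K = q"
    and finite_Z: "finite Z" and card_Z: "card Z = q ^ t - 1"
    and I_lists: "I \<subseteq> {us. set us \<subseteq> Z \<and> length us = t}"
    and card_I: "card I = (\<Prod>i<t. q ^ t - q ^ i)"
    and I_distinct: "us \<in> I \<Longrightarrow> distinct us"
    and I_perm: "us \<in> I \<Longrightarrow> set vs = set us \<Longrightarrow> length vs = t \<Longrightarrow> vs \<in> I"
    and I_surj: "us \<in> I \<Longrightarrow> set ks \<subseteq> K \<Longrightarrow> length ks = t \<Longrightarrow> \<exists>r\<in>R. map (ent r) us = ks"
    and ent_K: "r \<in> R \<Longrightarrow> u \<in> Z \<Longrightarrow> ent r u \<in> K"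
    and rep_Z: "u \<in> Z \<Longrightarrow> rep u \<in> Z"
    and rep_fibre: "u \<in> Z \<Longrightarrow> card {v \<in> Z. rep v = rep u} = q - 1"
    and rep_I: "set us \<subseteq> Z \<Longrightarrow> map rep us \<in> I \<longleftrightarrow> us \<in> I"

text \<open>
  The type is that of the elements of an algebraic closure of the prime field, where the two
  fields are found. Any \<open>K\<close>-basis is covered because the rows restrict to it bijectively.
\<close>
theorem exists_linear_columns:
  assumes "primepow q" and t: "t > 0"
  obtains R :: "((int list \<times> nat) multiset \<Rightarrow> int) set"
    and K :: "((int list \<times> nat) multiset \<Rightarrow> int) set"
    and ent and Z :: "((int list \<times> nat) multiset \<Rightarrow> int) set" and I rep
  where "linear_columns q t R K ent Z I rep"
proof -
  obtain p n where p: "prime p" and n: "n > 0" and q: "q = p ^ n"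
    using assms(1) unfolding primepow_def by auto
  have q2: "q \<ge> 2" using assms(1) primepow_gt_Suc_0 by force
  obtain L :: "(((int list \<times> nat) multiset) \<Rightarrow> int) ring" and K E where
    L: "field L" and K: "subfield K L" and E: "subfield E L" and KE: "K \<subseteq> E"
    and cK: "card K = p ^ n" and cE: "card E = p ^ (n * t)"
    using finite_field_tower[OF p n t] by metis
  interpret L: field L by (rule L)
  have cardK: "card K = q" and cardE: "card E = card K ^ t"
    using cK cE unfolding q by (auto simp: power_mult)
  have fin: "finite K" "finite E" using cardK cardE q2 by (auto intro!: card_ge_0_finite)
  note Er = subringE[OF subfieldE(1)[OF E]]
  note Kr = subringE[OF subfieldE(1)[OF K]]
  have EL: "x \<in> carrier L" if "x \<in> E" for x using that Er(1) by auto
  obtain lam where lam: "\<And>x. x \<in> E \<Longrightarrow> lam x \<in> K"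
    "\<And>x y. x \<in> E \<Longrightarrow> y \<in> E \<Longrightarrow> lam (x \<oplus>\<^bsub>L\<^esub> y) = lam x \<oplus>\<^bsub>L\<^esub> lam y"
    "\<And>k x. k \<in> K \<Longrightarrow> x \<in> E \<Longrightarrow> lam (k \<otimes>\<^bsub>L\<^esub> x) = k \<otimes>\<^bsub>L\<^esub> lam x"
    "\<exists>x\<in>E. lam x \<noteq> \<zero>\<^bsub>L\<^esub>"
    using L.exists_linear_functional[OF K fin(1) E fin(2) KE cardE t] by blast
  define Z where "Z = E - {\<zero>\<^bsub>L\<^esub>}"
  define I where "I = {us. set us \<subseteq> E \<and> length us = t \<and> L.independent K us}"
  define proportional where "proportional = (\<lambda>u v. \<exists>k\<in>K - {\<zero>\<^bsub>L\<^esub>}. v = k \<otimes>\<^bsub>L\<^esub> u)"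
  define rep where "rep = (\<lambda>u. SOME v. proportional u v)"
  have proportional_refl: "proportional u u" if "u \<in> Z" for u
    unfolding proportional_def using that EL Kr(3) unfolding Z_def by (intro bexI[of _ "\<one>\<^bsub>L\<^esub>"]) auto
  have proportional_sym: "proportional v u" if "u \<in> Z" "proportional u v" for u v
  proof -
    from that obtain k where k: "k \<in> K - {\<zero>\<^bsub>L\<^esub>}" "v = k \<otimes>\<^bsub>L\<^esub> u" unfolding proportional_def by auto
    note i = L.subfield_m_inv[OF K k(1)]
    have "inv\<^bsub>L\<^esub> k \<otimes>\<^bsub>L\<^esub> v = u"
      using k i that EL Kr(1) unfolding Z_def by (simp add: subset_iff flip: L.m_assoc)
    then show ?thesis unfolding proportional_def using i(1) by auto
  qed
  have proportional_trans: "proportional u w" if "u \<in> Z" "proportional u v" "proportional v w" for u v w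
  proof -
    from that obtain k l where k: "k \<in> K - {\<zero>\<^bsub>L\<^esub>}" "v = k \<otimes>\<^bsub>L\<^esub> u" and l: "l \<in> K - {\<zero>\<^bsub>L\<^esub>}" "w = l \<otimes>\<^bsub>L\<^esub> v"
      unfolding proportional_def by auto
    have "w = (l \<otimes>\<^bsub>L\<^esub> k) \<otimes>\<^bsub>L\<^esub> u"
      using k l that EL Kr(1) unfolding Z_def by (auto simp: subset_iff L.m_assoc)
    moreover have "l \<otimes>\<^bsub>L\<^esub> k \<in> K - {\<zero>\<^bsub>L\<^esub>}"
      using k l Kr(1,6) L.integral[of l k] by blast
    ultimately show ?thesis unfolding proportional_def by blast
  qed
  have proportional_Z: "v \<in> Z" if "u \<in> Z" "proportional u v" for u v
  proof -
    from that obtain k where k: "k \<in> K - {\<zero>\<^bsub>L\<^esub>}" "v = k \<otimes>\<^bsub>L\<^esub> u" unfolding proportional_def by auto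
    have "k \<in> E" "u \<in> E" using k KE that unfolding Z_def by auto
    then have "v \<in> E" "v \<noteq> \<zero>\<^bsub>L\<^esub>" using k that Er(6) EL L.integral[of k u] unfolding Z_def by auto
    then show ?thesis unfolding Z_def by simp
  qed
  have rep_proportional: "proportional u (rep u)" if "u \<in> Z" for u
    unfolding rep_def by (rule someI[of "proportional u", OF proportional_refl[OF that]])
  have repZ: "rep u \<in> Z" if "u \<in> Z" for u using proportional_Z[OF that rep_proportional[OF that]] .
  have rep_eq: "rep u = rep v \<longleftrightarrow> proportional u v" if "u \<in> Z" "v \<in> Z" for u v
  proof
    assume "rep u = rep v"
    then have "proportional u (rep v)" using rep_proportional[OF that(1)] by simp
    then show "proportional u v" using proportional_trans[OF that(1)] proportional_sym[OF that(2) rep_proportional[OF that(2)]] by blast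
  next
    assume "proportional u v"
    then have "proportional u = proportional v" using that proportional_sym proportional_trans by blast
    then show "rep u = rep v" unfolding rep_def by simp
  qed
  show thesis
  proof (rule that[of E K "\<lambda>r u. lam (r \<otimes>\<^bsub>L\<^esub> u)" Z I rep], unfold_locales)
    show "q \<ge> 2" "card K = q" by (fact q2 cardK)+
    show "card E = q ^ t" using cardE cardK by simp
    show "finite Z" "card Z = q ^ t - 1" unfolding Z_def using fin Er(2) cardE cardK by simp_all
    show "I \<subseteq> {us. set us \<subseteq> Z \<and> length us = t}"
      unfolding I_def Z_def using L.zero_notin_independent[OF K] by auto
    show "card I = (\<Prod>i<t. q ^ t - q ^ i)"
      unfolding I_def L.card_independent_lists[OF K fin(1) E fin(2) KE] cardE cardK ..
    show "distinct us" if "us \<in> I" for us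
      using that L.independent_distinct[OF K] unfolding I_def by auto
    show "vs \<in> I" if "us \<in> I" "set vs = set us" "length vs = t" for us vs
      using that L.independent_same_set[OF K, of us vs] unfolding I_def by auto
    show "\<exists>r\<in>E. map (\<lambda>u. lam (r \<otimes>\<^bsub>L\<^esub> u)) us = ks" if "us \<in> I" "set ks \<subseteq> K" "length ks = t" for us ks
    proof -
      have us: "L.independent K us" "set us \<subseteq> E" "length us = t" using that(1) unfolding I_def by auto
      have "ks \<in> {Ks. set Ks \<subseteq> K \<and> length Ks = t}" using that by simp
      then have "ks \<in> (\<lambda>r. map (\<lambda>u. lam (r \<otimes>\<^bsub>L\<^esub> u)) us) ` E"
        using L.bij_betw_functional_array[OF K fin(1) E fin(2) KE cardE lam us] unfolding bij_betw_def by simp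
      then show ?thesis by blast
    qed
    show "lam (r \<otimes>\<^bsub>L\<^esub> u) \<in> K" if "r \<in> E" "u \<in> Z" for r u
      using that lam(1) Er(6) unfolding Z_def by auto
    show "rep u \<in> Z" if "u \<in> Z" for u by (rule repZ[OF that])
    show "card {v \<in> Z. rep v = rep u} = q - 1" if u: "u \<in> Z" for u
    proof -
      have uc: "u \<in> carrier L" "u \<noteq> \<zero>\<^bsub>L\<^esub>" using u EL unfolding Z_def by auto
      have "rep v = rep u \<longleftrightarrow> proportional u v" if "v \<in> Z" for v
        unfolding rep_eq[OF u that, symmetric] by (rule eq_commute)
      then have "{v \<in> Z. rep v = rep u} = {v \<in> Z. proportional u v}" by blast
      also have "\<dots> = (\<lambda>k. k \<otimes>\<^bsub>L\<^esub> u) ` (K - {\<zero>\<^bsub>L\<^esub>})"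
      proof (intro equalityI subsetI)
        fix v assume "v \<in> (\<lambda>k. k \<otimes>\<^bsub>L\<^esub> u) ` (K - {\<zero>\<^bsub>L\<^esub>})"
        then have "proportional u v" unfolding proportional_def by auto
        then show "v \<in> {v \<in> Z. proportional u v}" using proportional_Z[OF u] by simp
      qed (auto simp: proportional_def)
      also have "card \<dots> = card (K - {\<zero>\<^bsub>L\<^esub>})"
      proof (intro card_image inj_onI)
        fix k l assume "k \<in> K - {\<zero>\<^bsub>L\<^esub>}" "l \<in> K - {\<zero>\<^bsub>L\<^esub>}" and eq: "k \<otimes>\<^bsub>L\<^esub> u = l \<otimes>\<^bsub>L\<^esub> u"
        then have "k \<in> carrier L" "l \<in> carrier L" using Kr(1) by auto
        then show "k = l" using L.m_rcancel[OF uc(2,1)] eq by simp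
      qed
      also have "\<dots> = q - 1" using fin Kr(2) cardK by simp
      finally show ?thesis .
    qed
    show "map rep us \<in> I \<longleftrightarrow> us \<in> I" if us: "set us \<subseteq> Z" for us
    proof -
      have "list_all2 proportional us (map rep us)" "list_all2 proportional (map rep us) us"
        using us rep_proportional proportional_sym by (simp_all add: list_all2_map1 list_all2_map2 list_all2_same subset_iff)
      then have "L.independent K us \<longleftrightarrow> L.independent K (map rep us)"
        using L.independent_scale[OF K, of us "map rep us"] L.independent_scale[OF K, of "map rep us" us]
        unfolding proportional_def by blast
      moreover have "set (map rep us) \<subseteq> E" "set us \<subseteq> E"
        using us repZ unfolding Z_def by auto
      ultimately show ?thesis unfolding I_def by simp
    qed
  qed
qed

section \<open>The lower bounds\<close>

lemma card_preimage:
  assumes "finite P" "finite B" and "\<And>u. u \<in> B \<Longrightarrow> card {x \<in> P. h x = u} * m = n"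
  shows "card {x \<in> P. h x \<in> B} * m = card B * n"
proof -
  have "{x \<in> P. h x \<in> B} = (\<Union>u\<in>B. {x \<in> P. h x = u})" by auto
  then have "card {x \<in> P. h x \<in> B} = (\<Sum>u\<in>B. card {x \<in> P. h x = u})"
    using assms(1,2) by (simp only:) (rule card_UN_disjoint, auto)
  then have "card {x \<in> P. h x \<in> B} * m = (\<Sum>u\<in>B. card {x \<in> P. h x = u} * m)"
    by (simp only: sum_distrib_right)
  also have "\<dots> = (\<Sum>u\<in>B. n)" using assms(3) by (intro sum.cong) auto
  finally show ?thesis by simp
qed

lemma card_lists_over_list:
  assumes D: "finite D" and fib: "\<And>u. u \<in> U \<Longrightarrow> card {x \<in> D. g x = u} = s"
  shows "set us \<subseteq> U \<Longrightarrow> card {xs. set xs \<subseteq> D \<and> map g xs = us} = s ^ length us"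
proof (induction us)
  case Nil
  have "{xs. set xs \<subseteq> D \<and> map g xs = []} = {[]}" by auto
  then show ?case by simp
next
  case (Cons u us)
  have "{xs. set xs \<subseteq> D \<and> map g xs = u # us} =
      (\<lambda>(x, xs). x # xs) ` ({x \<in> D. g x = u} \<times> {xs. set xs \<subseteq> D \<and> map g xs = us})"
    by (auto simp: map_eq_Cons_conv image_iff)
  moreover have "inj_on (\<lambda>(x, xs). x # xs) ({x \<in> D. g x = u} \<times> {xs. set xs \<subseteq> D \<and> map g xs = us})"
    by (auto simp: inj_on_def)
  ultimately have "card {xs. set xs \<subseteq> D \<and> map g xs = u # us} =
      card ({x \<in> D. g x = u} \<times> {xs. set xs \<subseteq> D \<and> map g xs = us})"
    by (simp only: card_image)
  then show ?case using Cons fib by (simp add: card_cartesian_product)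
qed

text \<open>
  Replacing a column by \<open>s\<close> copies multiplies the number of tuples in \<open>B\<close> by \<open>s ^ t\<close>. This is used both for
  copies of columns and for the \<open>q - 1\<close> nonzero multiples of a vector.
\<close>
lemma card_lists_over:
  assumes D: "finite D" and fib: "\<And>u. u \<in> U \<Longrightarrow> card {x \<in> D. g x = u} = s"
    and B: "finite B" "\<And>us. us \<in> B \<Longrightarrow> set us \<subseteq> U \<and> length us = t"
  shows "card {xs. set xs \<subseteq> D \<and> length xs = t \<and> map g xs \<in> B} = s ^ t * card B"
proof -
  let ?P = "{xs. set xs \<subseteq> D \<and> length xs = t}"
  have "card {xs \<in> ?P. map g xs \<in> B} * 1 = card B * s ^ t"
  proof (rule card_preimage)
    show "finite ?P" by (rule finite_lists_length_eq[OF D])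
    fix us assume us: "us \<in> B"
    have "{xs \<in> ?P. map g xs = us} = {xs. set xs \<subseteq> D \<and> map g xs = us}"
      using B(2)[OF us] by auto
    then show "card {xs \<in> ?P. map g xs = us} * 1 = s ^ t"
      using card_lists_over_list[of D U g s us] D fib B(2)[OF us] by simp
  qed (rule B(1))
  then show ?thesis by (simp add: conj_assoc mult.commute)
qed

lemma obtain_map_eq:
  assumes "distinct xs" "length us = length xs"
  obtains g where "map g xs = us"
proof
  show "map (\<lambda>x. the (map_of (zip xs us) x)) xs = us"
    using assms by (intro nth_equalityI) (auto simp: map_of_zip_nth)
qed

lemma finite_cov_values: "finite (cov N t k S ` arrays N k S)"
proof -
  have "cov N t k S A \<le> card (Pow {..<k})" for A :: "nat \<Rightarrow> nat \<Rightarrow> 'a"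
    unfolding cov_def by (intro card_mono) auto
  then have "cov N t k S ` arrays N k S \<subseteq> {..card (Pow {..<k})}" by blast
  then show ?thesis by (rule finite_subset) (rule finite_atMost)
qed

lemma cov_le_cov_max: "A \<in> arrays N k S \<Longrightarrow> cov N t k S A \<le> cov_max N t k S"
  unfolding cov_max_def by (intro Max_ge finite_cov_values) simp

lemma cov_max_attained:
  assumes "S \<noteq> {}"
  obtains A where "A \<in> arrays N k S" "cov_max N t k S = cov N t k S A"
proof -
  obtain a where "a \<in> S" using assms by auto
  then have "(\<lambda>i j. a) \<in> arrays N k S" unfolding arrays_def by simp
  then have "cov N t k S ` arrays N k S \<noteq> {}" by blast
  then have "cov_max N t k S \<in> cov N t k S ` arrays N k S"
    unfolding cov_max_def by (rule Max_in[OF finite_cov_values])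
  then show thesis using that by auto
qed

context linear_columns
begin

text \<open>
  The order in which the columns of \<open>Q\<close> are listed does not matter, as \<open>I\<close> is closed under permutations;
  increasing order matches the subarrays.
\<close>
definition independent_sets :: "(nat \<Rightarrow> 'c) \<Rightarrow> nat \<Rightarrow> nat set set" where
  "independent_sets f k = {Q. Q \<subseteq> {..<k} \<and> card Q = t \<and> map f (sorted_list_of_set Q) \<in> I}"

lemma finite_I: "finite I"
  by (rule finite_subset[OF I_lists finite_lists_length_eq[OF finite_Z]])

lemma card_independent_sets_le_cov_max:
  assumes S: "finite (S :: 'a set)" "card S = q" and f: "\<And>j. j < k \<Longrightarrow> f j \<in> Z"
  shows "card (independent_sets f k) \<le> cov_max (q ^ t) t k S"
proof -
  have "finite R" "finite K" using card_R card_K q by (auto intro!: card_ge_0_finite)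
  obtain \<rho> where \<rho>: "bij_betw \<rho> {..<q ^ t} R"
    using finite_same_card_bij[of "{..<q ^ t}" R] \<open>finite R\<close> card_R by auto
  obtain \<beta> where \<beta>: "bij_betw \<beta> K S"
    using finite_same_card_bij[of K S] \<open>finite K\<close> S card_K by auto
  define A where "A = (\<lambda>i j. \<beta> (ent (\<rho> i) (f j)))"
  have AS: "A \<in> arrays (q ^ t) k S"
    unfolding arrays_def A_def using ent_K f bij_betwE[OF \<rho>] bij_betwE[OF \<beta>] by auto
  have cov: "covers (q ^ t) S A Q" if Q: "Q \<in> independent_sets f k" for Q
    unfolding covers_def
  proof (intro allI impI, elim conjE)
    fix xs assume xs: "set xs \<subseteq> S" "length xs = card Q"
    define ks where "ks = map (inv_into K \<beta>) xs"
    have im: "\<beta> ` K = S" using \<beta> by (rule bij_betw_imp_surj_on)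
    have ks: "set ks \<subseteq> K" "length ks = t"
      using xs Q im inv_into_into[of _ \<beta> K] unfolding ks_def independent_sets_def by auto
    have "map f (sorted_list_of_set Q) \<in> I" using Q unfolding independent_sets_def by simp
    from I_surj[OF this ks] obtain r where r: "r \<in> R" "map (ent r) (map f (sorted_list_of_set Q)) = ks" by auto
    obtain i where i: "i < q ^ t" "\<rho> i = r" using r(1) bij_betw_imp_surj_on[OF \<rho>] by auto
    have "subarray_row A Q i = map \<beta> (map (ent r) (map f (sorted_list_of_set Q)))"
      unfolding subarray_row_def A_def i(2) by simp
    also have "\<dots> = map (\<lambda>x. \<beta> (inv_into K \<beta> x)) xs" unfolding r(2) ks_def by simp
    also have "\<dots> = xs" using xs(1) im by (intro map_idI f_inv_into_f) auto
    finally show "\<exists>i<q ^ t. subarray_row A Q i = xs" using i(1) by blast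
  qed
  have "card (independent_sets f k) \<le> cov (q ^ t) t k S A"
    unfolding cov_def
  proof (rule card_mono)
    show "finite {Q. Q \<subseteq> {..<k} \<and> card Q = t \<and> covers (q ^ t) S A Q}"
      by (rule finite_subset[of _ "Pow {..<k}"]) auto
    show "independent_sets f k \<subseteq> {Q. Q \<subseteq> {..<k} \<and> card Q = t \<and> covers (q ^ t) S A Q}"
      using cov unfolding independent_sets_def by blast
  qed
  then show ?thesis using cov_le_cov_max[OF AS] le_trans by blast
qed

lemma cov_const_eq: "cov_const t q = real (card I) / real (card Z) ^ t"
proof -
  have "real (q ^ t - q ^ i) = real q ^ t - real q ^ i" if "i < t" for i
    using that q by (subst of_nat_diff) (auto intro: power_increasing)
  then have "real (card I) = (\<Prod>i<t. real q ^ t - real q ^ i)"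
    unfolding card_I of_nat_prod by (intro prod.cong) auto
  moreover have "real (card Z) = real q ^ t - 1"
    unfolding card_Z using q by (subst of_nat_diff) auto
  ultimately show ?thesis unfolding cov_const_def by (simp add: prod_dividef)
qed

lemma card_Z_pos: "t > 0 \<Longrightarrow> card Z > 0"
  unfolding card_Z using q one_less_power[of q t] by simp

text \<open>
  Average over all maps from the columns to \<open>Z\<close>. For a fixed \<open>t\<close>-set \<open>Q\<close> the restriction to \<open>Q\<close> of such a map takes
  every value equally often, so a proportion \<open>card I / card Z ^ t = cov_const t q\<close> of the maps covers \<open>Q\<close>.
\<close>
theorem cov_max_ge_average:
  assumes S: "finite S" "card S = q" and t: "t > 0"
  shows "cov_const t q * real (k choose t) \<le> real (cov_max (q ^ t) t k S)"
proof -
  let ?F = "{..<k} \<rightarrow>\<^sub>E Z" and ?\<Q> = "{Q. Q \<subseteq> {..<k} \<and> card Q = t}" and ?M = "cov_max (q ^ t) t k S"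
  have fin: "finite ?F" "finite ?\<Q>" using finite_Z by (auto intro!: finite_PiE finite_subset[of ?\<Q> "Pow {..<k}"])
  have count: "card {f \<in> ?F. map f (sorted_list_of_set Q) \<in> I} * card Z ^ t = card I * card Z ^ k"
    if Q: "Q \<in> ?\<Q>" for Q
  proof (rule card_preimage[OF fin(1) finite_I])
    fix us assume us: "us \<in> I"
    have finQ: "finite Q" using Q finite_subset by blast
    have usZ: "set us \<subseteq> Z" "length us = t" using us I_lists by auto
    obtain g where g: "map g (sorted_list_of_set Q) = us"
      using obtain_map_eq[of "sorted_list_of_set Q" us] usZ Q by auto
    have "set (map g (sorted_list_of_set Q)) \<subseteq> Z" unfolding g by (rule usZ)
    then have gZ: "g c \<in> Z" if "c \<in> Q" for c using that finQ by auto
    have "{f \<in> ?F. map f (sorted_list_of_set Q) = us} = {f \<in> ?F. \<forall>c\<in>Q. f c = g c}"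
      unfolding g[symmetric] using finQ by auto
    then show "card {f \<in> ?F. map f (sorted_list_of_set Q) = us} * card Z ^ t = card Z ^ k"
      using card_PiE_prescribed[of "{..<k}" Q g Z] Q gZ by auto
  qed
  have "(\<Sum>f\<in>?F. card (independent_sets f k)) = (\<Sum>f\<in>?F. \<Sum>Q | Q \<in> ?\<Q> \<and> map f (sorted_list_of_set Q) \<in> I. 1)"
    unfolding independent_sets_def by (simp add: conj_assoc)
  also have "\<dots> = (\<Sum>Q\<in>?\<Q>. \<Sum>f | f \<in> ?F \<and> map f (sorted_list_of_set Q) \<in> I. 1)"
    using fin by (rule sum.swap_restrict)
  also have "\<dots> = (\<Sum>Q\<in>?\<Q>. card {f \<in> ?F. map f (sorted_list_of_set Q) \<in> I})" by simp
  finally have "(\<Sum>f\<in>?F. card (independent_sets f k)) * card Z ^ t =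
      (\<Sum>Q\<in>?\<Q>. card {f \<in> ?F. map f (sorted_list_of_set Q) \<in> I} * card Z ^ t)"
    by (simp only: sum_distrib_right)
  also have "\<dots> = (\<Sum>Q\<in>?\<Q>. card I * card Z ^ k)" by (rule sum.cong[OF refl count])
  also have "\<dots> = (k choose t) * (card I * card Z ^ k)"
    using n_subsets[of "{..<k}" t] by simp
  finally have total: "(\<Sum>f\<in>?F. card (independent_sets f k)) * card Z ^ t = (k choose t) * (card I * card Z ^ k)" .
  have "(\<Sum>f\<in>?F. card (independent_sets f k)) \<le> (\<Sum>f\<in>?F. ?M)"
    by (intro sum_mono card_independent_sets_le_cov_max S) auto
  also have "\<dots> = card Z ^ k * ?M" by (simp add: card_funcsetE)
  finally have "(k choose t) * (card I * card Z ^ k) \<le> card Z ^ k * ?M * card Z ^ t"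
    unfolding total[symmetric] by (rule mult_right_mono) simp
  then have "card Z ^ k * ((k choose t) * card I) \<le> card Z ^ k * (?M * card Z ^ t)"
    by (simp only: mult_ac)
  then have "(k choose t) * card I \<le> ?M * card Z ^ t" using card_Z_pos[OF t] by simp
  then have "real ((k choose t) * card I) \<le> real (?M * card Z ^ t)" by (simp only: of_nat_le_iff)
  then show ?thesis unfolding cov_const_eq using card_Z_pos[OF t] by (simp add: field_simps)
qed

text \<open>
  Give each line the same number \<open>s\<close> of columns. Ordered covered tuples are then counted by
  passing from vectors to lines, which divides \<open>card I\<close> by \<open>(q - 1) ^ t\<close>, and from lines to columns, which
  multiplies by \<open>s ^ t\<close>; every covered set comes from at most \<open>t!\<close> tuples.
\<close>
theorem cov_max_ge_balanced:
  assumes S: "finite S" "card S = q" and t: "t > 0" and k: "k > 0" "(q ^ t - 1) div (q - 1) dvd k"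
  shows "cov_const t q * (real k ^ t / fact t) \<le> real (cov_max (q ^ t) t k S)"
proof -
  define P where "P = rep ` Z"
  have finP: "finite P" unfolding P_def using finite_Z by simp
  have PZ: "P \<subseteq> Z" unfolding P_def using rep_Z by auto
  have fibP: "card {u \<in> Z. rep u = p} = q - 1" if "p \<in> P" for p
    using that rep_fibre unfolding P_def by auto
  have "card {u \<in> Z. rep u \<in> P} * 1 = card P * (q - 1)"
    using fibP by (intro card_preimage finite_Z finP) simp
  moreover have "{u \<in> Z. rep u \<in> P} = Z" unfolding P_def by auto
  ultimately have ZP: "card Z = card P * (q - 1)" by simp
  then have "(q ^ t - 1) div (q - 1) = card P" using q unfolding card_Z by simp
  then obtain s where s: "k = card P * s" using k(2) by auto
  obtain e where e: "bij_betw e {..<card P} P"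
    using finite_same_card_bij[of "{..<card P}" P] finP by auto
  have s0: "s > 0" using s k(1) by (cases s) auto
  define f where "f = (\<lambda>j. e (j div s))"
  have lt: "j div s < card P" if "j < k" for j
    using that s s0 by (simp add: less_mult_imp_div_less)
  have fP: "f j \<in> P" if "j < k" for j unfolding f_def using bij_betwE[OF e] lt[OF that] by auto
  have fibf: "card {j \<in> {..<k}. f j = p} = s" if p: "p \<in> P" for p
  proof -
    have "p \<in> e ` {..<card P}" using p bij_betw_imp_surj_on[OF e] by simp
    then obtain a where a: "a < card P" "e a = p" by auto
    have "{j \<in> {..<k}. f j = p} = {j \<in> {..<k}. j div s = a}"
      using lt a bij_betw_imp_inj_on[OF e] unfolding f_def by (auto dest: inj_onD)
    also have "\<dots> = {a * s..<a * s + s}"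
    proof (intro equalityI subsetI)
      fix j assume "j \<in> {j \<in> {..<k}. j div s = a}"
      then have "a * s + j mod s = j" using div_mult_mod_eq[of j s] by simp
      moreover have "j mod s < s" using s0 by simp
      ultimately show "j \<in> {a * s..<a * s + s}" unfolding atLeastLessThan_iff by linarith
    next
      fix j assume j: "j \<in> {a * s..<a * s + s}"
      then have "j div s = a" using s0 by (intro div_nat_eqI) (auto simp: mult.commute)
      moreover have "a * s + s \<le> k" using a(1) mult_le_mono1[of "Suc a" "card P" s] unfolding s by simp
      ultimately show "j \<in> {j \<in> {..<k}. j div s = a}" using j by auto
    qed
    finally show ?thesis by simp
  qed
  define IP where "IP = {us \<in> I. set us \<subseteq> P}"
  have IPf: "finite IP" unfolding IP_def using finite_I by simp
  have IPl: "set us \<subseteq> P \<and> length us = t" if "us \<in> IP" for us using that I_lists unfolding IP_def by auto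
  have "{us. set us \<subseteq> Z \<and> length us = t \<and> map rep us \<in> IP} = I"
  proof (intro equalityI subsetI)
    fix us assume us: "us \<in> I"
    then have "set us \<subseteq> Z" "length us = t" using I_lists by auto
    moreover have "set (map rep us) \<subseteq> P" using \<open>set us \<subseteq> Z\<close> unfolding P_def by auto
    ultimately show "us \<in> {us. set us \<subseteq> Z \<and> length us = t \<and> map rep us \<in> IP}"
      using us rep_I unfolding IP_def by simp
  qed (use rep_I in \<open>auto simp: IP_def\<close>)
  then have cI: "card I = (q - 1) ^ t * card IP"
    using card_lists_over[OF finite_Z fibP IPf IPl] by simp
  define L where "L = {js. set js \<subseteq> {..<k} \<and> length js = t \<and> map f js \<in> IP}"
  have cL: "card L = s ^ t * card IP"
    unfolding L_def by (rule card_lists_over[OF _ fibf IPf IPl]) auto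
  have finL: "finite L" unfolding L_def
    by (rule finite_subset[OF _ finite_lists_length_eq[of "{..<k}" t]]) auto
  have finG: "finite (independent_sets f k)" unfolding independent_sets_def
    by (rule finite_subset[of _ "Pow {..<k}"]) auto
  have Ldist: "distinct js" "set js \<in> independent_sets f k" if js: "js \<in> L" for js
  proof -
    have I: "map f js \<in> I" and jk: "set js \<subseteq> {..<k}" "length js = t" using js unfolding L_def IP_def by auto
    show d: "distinct js" using I_distinct[OF I] by (simp add: distinct_map)
    have "map f (sorted_list_of_set (set js)) \<in> I"
      using d jk by (intro I_perm[OF I]) (auto simp: distinct_card)
    then show "set js \<in> independent_sets f k" unfolding independent_sets_def using d jk by (simp add: distinct_card)
  qed
  have "L = (\<Union>Q\<in>independent_sets f k. {js \<in> L. set js = Q})" using Ldist(2) by auto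
  then have "card L \<le> (\<Sum>Q\<in>independent_sets f k. card {js \<in> L. set js = Q})"
    using card_UN_le[OF finG] by metis
  also have "\<dots> \<le> (\<Sum>Q\<in>independent_sets f k. fact t)"
  proof (rule sum_mono)
    fix Q assume Q: "Q \<in> independent_sets f k"
    then have "card Q = t" "finite Q" unfolding independent_sets_def by (auto intro: finite_subset)
    then have "card (permutations_of_set Q) = fact t" by (simp add: card_permutations_of_set)
    moreover have "{js \<in> L. set js = Q} \<subseteq> permutations_of_set Q"
      using Ldist(1) by (auto simp: permutations_of_set_def)
    ultimately show "card {js \<in> L. set js = Q} \<le> fact t"
      using card_mono[of "permutations_of_set Q"] by (metis finite_permutations_of_set)
  qed
  also have "\<dots> = card (independent_sets f k) * fact t" by simp
  also have "\<dots> \<le> cov_max (q ^ t) t k S * fact t"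
    using fP PZ by (intro mult_right_mono card_independent_sets_le_cov_max S) auto
  finally have main: "s ^ t * card IP \<le> cov_max (q ^ t) t k S * fact t" unfolding cL .
  have q1: "real (q - 1) > 0" using q by simp
  have P0: "real (card P) > 0" using s k(1) by (simp add: gr0I)
  have "cov_const t q * real k ^ t = real (s ^ t * card IP)"
    unfolding cov_const_eq cI ZP s using q1 P0 by (simp add: power_mult_distrib)
  also have "\<dots> \<le> real (cov_max (q ^ t) t k S * fact t)" using main by (simp only: of_nat_le_iff)
  finally show ?thesis by (simp add: field_simps)
qed

end

section \<open>The maximum coverage function at \<open>v ^ t\<close> rows\<close>

theorem theorem1p7:
  fixes S :: "'s set" and t v k :: nat
  assumes "t \<ge> 2" and "v \<ge> 2"
    and "finite S" and "card S = v"
    and "k \<ge> t"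
  shows "real (cov_max (v ^ t) t k S) \<le> cov_const t v * (real k ^ t / fact t)
    \<and> (primepow v \<and> ((v ^ t - 1) div (v - 1)) dvd k \<longrightarrow>
         real (cov_max (v ^ t) t k S) = cov_const t v * (real k ^ t / fact t))
    \<and> (primepow v \<longrightarrow>
         real (cov_max (v ^ t) t k S) \<ge> cov_const t v * real (k choose t))"
proof -
  have t: "t > 0" and k: "k > 0" using assms by auto
  have upper: "real (cov_max (v ^ t) t k S) \<le> cov_const t v * (real k ^ t / fact t)"
  proof -
    obtain A where "A \<in> arrays (v ^ t) k S" "cov_max (v ^ t) t k S = cov (v ^ t) t k S A"
    proof (rule cov_max_attained[where S = S and N = "v ^ t" and k = k and t = t])
      show "S \<noteq> {}" using assms by auto
    qed
    then show ?thesis using cov_upper_bound[OF assms(3,4,2) t] by simp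
  qed
  have equal: "real (cov_max (v ^ t) t k S) = cov_const t v * (real k ^ t / fact t)"
    if "primepow v" "(v ^ t - 1) div (v - 1) dvd k"
  proof (rule exists_linear_columns[OF that(1) t])
    fix R K ent Z I rep assume "linear_columns v t R K ent Z I rep"
    then interpret linear_columns v t R K ent Z I rep .
    show ?thesis using cov_max_ge_balanced[OF assms(3,4) t k that(2)] upper by simp
  qed
  have lower: "cov_const t v * real (k choose t) \<le> real (cov_max (v ^ t) t k S)" if "primepow v"
  proof (rule exists_linear_columns[OF that t])
    fix R K ent Z I rep assume "linear_columns v t R K ent Z I rep"
    then interpret linear_columns v t R K ent Z I rep .
    show ?thesis by (rule cov_max_ge_average[OF assms(3,4) t])
  qed
  show ?thesis using upper equal lower by blast
qed

end
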